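(* Let $q_1,q_2\geq1$ be given coprime integers. When $p$ runs over primes and $H$ runs over the subgroups of $(\mathbb Z/p\mathbb Z)^*$ of odd order $d$, we have $$M_{q_1,q_2}(p,H)=\frac{\pi^2}{6q_1q_2}+O\!\left(d(\log p)^2p^{-\frac{1}{\phi(d)}}\right).$$
   Context: For a prime $p\geq3$ and a subgroup $H$ of $(\mathbb Z/p\mathbb Z)^*$ of odd order, $X_p^-(H)$ is the set of Dirichlet characters $\chi$ modulo $p$ with $\chi(-1)=-1$ and $\chi|_H=1$; $L(1,\chi)=\sum_{n\ge1}\chi(n)/n$; and $M_{q_1,q_2}(p,H)=\frac{1}{\#X_p^-(H)}\sum_{\chi\in X_p^-(H)}\chi(q_1)\overline{\chi}(q_2)|L(1,\chi)|^2.$ *)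

theory Defs
  imports Complex_Main "HOL-Number_Theory.Residues" "HOL-Number_Theory.Totient"
begin

text \<open>
  Dirichlet characters modulo \<open>n\<close> are viewed as functions on all of \<open>\<int>\<close>, extended by zero
  to the integers that are not coprime to \<open>n\<close>.
\<close>

definition dirichlet_character :: "nat \<Rightarrow> (int \<Rightarrow> complex) \<Rightarrow> bool" where
  "dirichlet_character n \<chi> \<longleftrightarrow>
     \<chi> 1 = 1 \<and>
     (\<forall>a b. \<chi> (a * b) = \<chi> a * \<chi> b) \<and>
     (\<forall>a. \<chi> (a + int n) = \<chi> a) \<and>
     (\<forall>a. \<chi> a = 0 \<longleftrightarrow> \<not> coprime a (int n))"

text \<open>
  The multiplicative group of \<open>\<int>/p\<int>\<close>; its elements are the representatives
  in \<open>{0..p - 1}\<close> that are invertible modulo \<open>p\<close>.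
\<close>

definition unit_group_mod :: "nat \<Rightarrow> int monoid" where
  "unit_group_mod p = units_of (residue_ring (int p))"

definition odd_chars :: "nat \<Rightarrow> int set \<Rightarrow> (int \<Rightarrow> complex) set" where
  "odd_chars p H = {\<chi>. dirichlet_character p \<chi> \<and> \<chi> (- 1) = - 1 \<and> (\<forall>h\<in>H. \<chi> h = 1)}"

text \<open>
  The series is shifted to start at \<open>n = 0\<close>. It converges only conditionally, so it is
  the limit of its partial sums in the natural order.
\<close>

definition L_one :: "(int \<Rightarrow> complex) \<Rightarrow> complex" where
  "L_one \<chi> = (\<Sum>n. \<chi> (int (Suc n)) / of_nat (Suc n))"

definition mean_square :: "nat \<Rightarrow> nat \<Rightarrow> nat \<Rightarrow> int set \<Rightarrow> complex" where
  "mean_square q1 q2 p H =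
     (1 / of_nat (card (odd_chars p H))) *
     (\<Sum>\<chi>\<in>odd_chars p H.
        \<chi> (int q1) * cnj (\<chi> (int q2)) * complex_of_real ((cmod (L_one \<chi>))\<^sup>2))"

end

theory Submission
  imports Defs "HOL-Computational_Algebra.Polynomial" "HOL-Analysis.Gamma_Function" "HOL-Number_Theory.Residue_Primitive_Roots"
begin

text \<open>
  For odd \<open>\<psi>\<close> the value \<open>L(1, \<psi>)\<close> is a finite cotangent sum, and by orthogonality over \<open>X\<^sub>p\<^sup>-(H)\<close>
  the mean is \<open>\<pi>\<^sup>2 / (2 p\<^sup>2)\<close> times the sum of \<open>cot (\<pi> q\<^sub>1 n / p) cot (\<pi> q\<^sub>2 h n / p)\<close> over
  \<open>h \<in> H\<close> and \<open>0 < n < p\<close>.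
  The term \<open>h = 1\<close> gives the main term, up to \<open>O(log p / p)\<close>.  For \<open>h \<noteq> 1\<close> let \<open>a, b\<close> be the absolutely
  least residues of \<open>q\<^sub>1 n\<close> and \<open>q\<^sub>2 h n\<close>; the inner sum is at most \<open>p\<^sup>2 \<Sum> 1 / \<bar>a b\<bar>\<close>.  The points
  \<open>(a, b)\<close> lie on a lattice of vectors with \<open>q\<^sub>1 b \<equiv> h q\<^sub>2 a (mod p)\<close>.  As \<open>h\<close> is a root modulo \<open>p\<close> of some
  cyclotomic polynomial \<open>\<Phi>\<^sub>e\<close> with \<open>e dvd d\<close>, \<open>e > 1\<close>, the norm of \<open>q\<^sub>1 b - q\<^sub>2 a \<zeta>\<^sub>e\<close> is a nonzero
  multiple of \<open>p\<close>, so all nonzero lattice vectors have length of order at least \<open>p powr (1 / \<phi>(d))\<close>.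
  Points that far apart satisfy \<open>\<Sum> 1 / \<bar>a b\<bar> = O((log p)\<^sup>2 p powr (- 1 / \<phi>(d)))\<close>.
\<close>

section \<open>Cyclotomic polynomials and short lattice vectors\<close>

definition prim_roots :: "nat \<Rightarrow> complex set" where
  "prim_roots n = {z. z ^ n = 1 \<and> (\<forall>k. 0 < k \<and> k < n \<longrightarrow> z ^ k \<noteq> 1)}"

definition cyclotomic :: "nat \<Rightarrow> complex poly" where
  "cyclotomic n = (\<Prod>z\<in>prim_roots n. [:- z, 1:])"

text \<open>Integrality is a predicate on complex polynomials, so that products over roots and
  integer coefficients live in one type.\<close>

definition int_coeffs :: "complex poly \<Rightarrow> bool" where
  "int_coeffs P \<longleftrightarrow> (\<forall>i. coeff P i \<in> \<int>)"

text \<open>Positivity excludes a degenerate case: \<open>prim_roots 0\<close> contains every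
  complex number.\<close>

lemma finite_prim_roots: "n > 0 \<Longrightarrow> finite (prim_roots n)"
  unfolding prim_roots_def
  by (rule finite_subset[OF _ finite_roots_unity[of n]]) auto

lemma norm_prim_root: "n > 0 \<Longrightarrow> z \<in> prim_roots n \<Longrightarrow> cmod z = 1"
  using power_eq_1_iff[of "cmod z" n] by (auto simp: prim_roots_def simp flip: norm_power)

text \<open>Dividing \<open>n\<close> by the least positive exponent that kills \<open>z\<close>
  leaves a smaller exponent that also kills \<open>z\<close>; minimality forces this remainder to be
  0.\<close>

lemma root_unity_order:
  fixes z :: complex
  assumes "n > 0" and "z ^ n = 1"
  obtains e where "e dvd n" "z \<in> prim_roots e"
proof -
  define e where "e = (LEAST k. 0 < k \<and> z ^ k = 1)"
  have e: "0 < e \<and> z ^ e = 1"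
    unfolding e_def by (rule LeastI[of _ n]) (use assms in auto)
  have least: "z ^ k \<noteq> 1" if "0 < k" "k < e" for k
    using not_less_Least[of k "\<lambda>k. 0 < k \<and> z ^ k = 1"] that by (auto simp: e_def)
  have "z ^ n = z ^ (e * (n div e) + n mod e)" by simp
  also have "\<dots> = z ^ (n mod e)" using e by (simp only: power_add power_mult) simp
  finally have "z ^ (n mod e) = 1" using assms by simp
  moreover have "n mod e < e" using e by simp
  ultimately have "n mod e = 0" using least[of "n mod e"] by (cases "n mod e = 0") auto
  then show ?thesis
    using that[of e] e least by (auto simp: prim_roots_def)
qed

lemma roots_unity_eq_Union:
  "n > 0 \<Longrightarrow> {z::complex. z ^ n = 1} = (\<Union>e\<in>{e. e dvd n}. prim_roots e)"
proof (intro equalityI subsetI)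
  fix z :: complex assume "n > 0" "z \<in> {z. z ^ n = 1}"
  then show "z \<in> (\<Union>e\<in>{e. e dvd n}. prim_roots e)" using root_unity_order[of n z] by blast
qed (auto simp: prim_roots_def power_mult elim!: dvdE)

lemma prim_roots_disjoint:
  assumes "d > 0" "e > 0" "d \<noteq> e"
  shows "prim_roots d \<inter> prim_roots e = {}"
  using assms by (auto simp: prim_roots_def) (metis linorder_neqE_nat)

text \<open>Both counts sum to \<open>n\<close> over the divisors of \<open>n\<close>. By strong
  induction the proper divisors cancel.\<close>

lemma card_prim_roots:
  assumes "n > 0"
  shows "card (prim_roots n) = totient n"
  using assms
proof (induction n rule: less_induct)
  case (less n)
  let ?D = "{e. e dvd n}"
  have fin: "finite ?D" using less.prems by simp
  have pos: "e > 0" if "e \<in> ?D" for e using that less.prems by (auto intro: Nat.gr0I)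
  have "n = card {z::complex. z ^ n = 1}"
    using card_roots_unity_eq[of n] less.prems by simp
  also have "\<dots> = (\<Sum>e\<in>?D. card (prim_roots e))"
    unfolding roots_unity_eq_Union[OF less.prems]
    using fin pos by (intro card_UN_disjoint ballI impI finite_prim_roots prim_roots_disjoint) auto
  also have "\<dots> = card (prim_roots n) + (\<Sum>e\<in>?D - {n}. card (prim_roots e))"
    using fin by (subst sum.remove[of _ n]) auto
  also have "(\<Sum>e\<in>?D - {n}. card (prim_roots e)) = (\<Sum>e\<in>?D - {n}. totient e)"
  proof (rule sum.cong[OF refl])
    fix e assume e: "e \<in> ?D - {n}"
    then have "e \<le> n" using less.prems by (auto intro: dvd_imp_le)
    then show "card (prim_roots e) = totient e"
      using e pos[of e] by (intro less.IH) auto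
  qed
  finally have "n = card (prim_roots n) + (\<Sum>e\<in>?D - {n}. totient e)" .
  moreover have "n = totient n + (\<Sum>e\<in>?D - {n}. totient e)"
    using fin totient_divisor_sum[of n] by (simp add: sum.remove[of _ n])
  ultimately show ?case by linarith
qed

lemma lead_coeff_cyclotomic [simp]: "lead_coeff (cyclotomic n) = 1"
  by (simp add: cyclotomic_def lead_coeff_prod)

lemma degree_cyclotomic: "n > 0 \<Longrightarrow> degree (cyclotomic n) = totient n"
  by (simp add: cyclotomic_def degree_prod_sum_eq card_prim_roots)

lemma poly_cyclotomic: "poly (cyclotomic n) w = (\<Prod>z\<in>prim_roots n. w - z)"
  by (simp add: cyclotomic_def poly_prod)

lemma prod_cyclotomic:
  assumes "n > 0"
  shows "(\<Prod>e | e dvd n. cyclotomic e) = monom 1 n - 1"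
proof -
  let ?R = "{z::complex. z ^ n = 1}"
  have fin: "finite {e. e dvd n}" using assms by simp
  have pos: "e > 0" if "e \<in> {e. e dvd n}" for e using that assms by (auto intro: Nat.gr0I)
  have "(\<Prod>e | e dvd n. cyclotomic e) = (\<Prod>z\<in>?R. [:- z, 1:])"
    unfolding roots_unity_eq_Union[OF assms] cyclotomic_def
    by (rule prod.UNION_disjoint[symmetric])
       (use fin pos in \<open>auto intro!: finite_prim_roots simp: prim_roots_disjoint\<close>)
  also have "\<dots> = monom 1 n - 1"
  \<comment> \<open>Two polynomials of degree at most \<open>n\<close> with the same coefficient at
    \<open>n\<close> that agree at \<open>n\<close> points are equal.\<close>
  proof (rule poly_eqI_degree_lead_coeff[where n = n and A = ?R])
    show "degree (\<Prod>z\<in>?R. [:- z, 1:]) \<le> n"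
      using card_roots_unity_eq[of n] assms by (simp add: degree_prod_sum_eq)
    show "degree (monom 1 n - 1 :: complex poly) \<le> n"
      by (intro degree_diff_le) (auto simp: degree_monom_le)
    have "coeff (\<Prod>z\<in>?R. [:- z, 1:]) (degree (\<Prod>z\<in>?R. [:- z, 1:])) = 1"
      by (simp add: lead_coeff_prod)
    then show "coeff (\<Prod>z\<in>?R. [:- z, 1:]) n = coeff (monom 1 n - 1 :: complex poly) n"
      using card_roots_unity_eq[of n] assms by (simp add: degree_prod_sum_eq)
    show "n \<le> card ?R" using card_roots_unity_eq[of n] assms by simp
  next
    fix w assume "w \<in> ?R"
    moreover have "finite ?R" using finite_roots_unity[of n] assms by simp
    ultimately show "poly (\<Prod>z\<in>?R. [:- z, 1:]) w = poly (monom 1 n - 1) w"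
      by (auto simp: poly_prod poly_monom)
  qed
  finally show ?thesis .
qed

section \<open>Integrality of cyclotomic polynomials and their homogenizations\<close>

lemma int_coeffs_mult: "int_coeffs P \<Longrightarrow> int_coeffs Q \<Longrightarrow> int_coeffs (P * Q)"
  by (auto simp: int_coeffs_def coeff_mult)

lemma int_coeffs_prod: "(\<And>x. x \<in> X \<Longrightarrow> int_coeffs (f x)) \<Longrightarrow> int_coeffs (prod f X)"
  by (induction X rule: infinite_finite_induct) (simp_all add: int_coeffs_mult, simp_all add: int_coeffs_def coeff_1)

text \<open>Since \<open>Q\<close> is monic, coefficient \<open>degree Q + i\<close> of the product
  is \<open>coeff R i\<close> plus terms that involve only higher coefficients of \<open>R\<close>.
  The induction therefore runs downwards from the top coefficient.\<close>

lemma int_coeffs_cofactor: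
  assumes P: "int_coeffs (Q * R)" and Q: "int_coeffs Q" and monic: "lead_coeff Q = 1"
  shows "int_coeffs R"
proof -
  have "coeff R i \<in> \<int>" for i
  proof (induction "Suc (degree R) - i" arbitrary: i rule: less_induct)
    case less
    show ?case
    proof (cases "i > degree R")
      case True
      then show ?thesis by (simp add: coeff_eq_0)
    next
      case False
      let ?m = "degree Q"
      let ?f = "\<lambda>k. coeff Q k * coeff R (?m + i - k)"
      have "?f k \<in> \<int>" if "k \<in> {..?m + i} - {?m}" for k
      proof (cases "k < ?m")
        case True
        then have "coeff R (?m + i - k) \<in> \<int>" using False by (intro less) auto
        then show ?thesis using Q by (auto simp: int_coeffs_def)
      next
        case False
        then have "k > ?m" using that by auto
        then show ?thesis by (simp add: coeff_eq_0)
      qed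
      then have "sum ?f ({..?m + i} - {?m}) \<in> \<int>" by (rule Ints_sum)
      moreover have "coeff (Q * R) (?m + i) = coeff R i + sum ?f ({..?m + i} - {?m})"
        unfolding coeff_mult using monic by (subst sum.remove[of _ ?m]) auto
      ultimately show ?thesis
        using P unfolding int_coeffs_def by (metis Ints_diff add_diff_cancel_right')
    qed
  qed
  then show ?thesis by (simp add: int_coeffs_def)
qed

text \<open>The factors of \<open>X^n - 1\<close> belonging to proper divisors form a monic integral
  product by induction, and \<open>cyclotomic n\<close> is its cofactor.\<close>

lemma int_coeffs_cyclotomic: "n > 0 \<Longrightarrow> int_coeffs (cyclotomic n)"
proof (induction n rule: less_induct)
  case (less n)
  let ?D = "{e. e dvd n}"
  let ?Q = "\<Prod>e\<in>?D - {n}. cyclotomic e"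
  have fin: "finite ?D" using less.prems by simp
  have "int_coeffs (cyclotomic e)" if "e \<in> ?D - {n}" for e
  proof -
    have "e \<le> n" using that less.prems by (auto intro: dvd_imp_le)
    then show ?thesis using that less.prems by (intro less.IH) (auto intro: Nat.gr0I)
  qed
  then have "int_coeffs ?Q" by (rule int_coeffs_prod)
  moreover have "lead_coeff ?Q = 1" by (simp add: lead_coeff_prod)
  moreover have "?Q * cyclotomic n = monom 1 n - 1"
    using fin by (subst prod_cyclotomic[OF less.prems, symmetric], subst prod.remove[of _ n]) auto
  then have "int_coeffs (?Q * cyclotomic n)"
    by (simp add: int_coeffs_def coeff_1)
  ultimately show ?case using int_coeffs_cofactor by blast
qed

text \<open>The witness is the binary form obtained by homogenizing \<open>P\<close>. Having integer
  coefficients, it takes integer values and respects congruences, which links a product of factors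
  \<open>y - z x\<close> over complex roots \<open>z\<close> with the value of \<open>P\<close> at
  \<open>h\<close> modulo \<open>m\<close>.\<close>

lemma int_coeffs_homogenize:
  assumes "int_coeffs P"
  shows "\<exists>G :: int \<Rightarrow> int \<Rightarrow> int.
    (\<forall>x y. x \<noteq> 0 \<longrightarrow> of_int (G y x) = of_int x ^ degree P * poly P (of_int y / of_int x)) \<and>
    (\<forall>m x y h. [y = h * x] (mod m) \<longrightarrow> [G y x = x ^ degree P * G h 1] (mod m))"
proof -
  from assms have "\<forall>i. \<exists>c::int. coeff P i = of_int c"
    by (auto simp: int_coeffs_def elim: Ints_cases)
  then obtain c :: "nat \<Rightarrow> int" where c: "\<And>i. coeff P i = of_int (c i)" by metis
  define G :: "int \<Rightarrow> int \<Rightarrow> int" where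
    "G y x = (\<Sum>i\<le>degree P. c i * y ^ i * x ^ (degree P - i))" for y x
  show ?thesis
  proof (intro exI[of _ G] conjI allI impI)
    fix x y :: int assume x: "x \<noteq> 0"
    have "of_int (G y x) = (\<Sum>i\<le>degree P. coeff P i * (of_int y ^ i * of_int x ^ (degree P - i)))"
      by (simp add: G_def c mult.assoc)
    also have "\<dots> = (\<Sum>i\<le>degree P. of_int x ^ degree P * (coeff P i * (of_int y / of_int x) ^ i))"
      using x by (intro sum.cong refl) (auto simp: power_diff power_divide field_simps)
    finally show "of_int (G y x) = of_int x ^ degree P * poly P (of_int y / of_int x)"
      by (simp add: poly_altdef sum_distrib_left)
  next
    fix m x y h :: int assume "[y = h * x] (mod m)"
    then have "[G y x = (\<Sum>i\<le>degree P. c i * (h * x) ^ i * x ^ (degree P - i))] (mod m)"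
      unfolding G_def by (intro cong_sum cong_mult cong_pow cong_refl)
    also have "(\<Sum>i\<le>degree P. c i * (h * x) ^ i * x ^ (degree P - i)) =
        (\<Sum>i\<le>degree P. x ^ degree P * (c i * h ^ i))"
    proof (intro sum.cong refl)
      fix i assume "i \<in> {..degree P}"
      then have "x ^ degree P = x ^ i * x ^ (degree P - i)" by (simp flip: power_add)
      then show "c i * (h * x) ^ i * x ^ (degree P - i) = x ^ degree P * (c i * h ^ i)"
        by (simp add: power_mult_distrib)
    qed
    also have "\<dots> = x ^ degree P * G h 1" by (simp add: G_def sum_distrib_left)
    finally show "[G y x = x ^ degree P * G h 1] (mod m)" .
  qed
qed

text \<open>If \<open>p\<close> does not divide \<open>x\<close>, a homogenized cyclotomic
  polynomial at \<open>(x, y)\<close> is a nonzero multiple of \<open>p\<close>, and it is a product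
  of at most \<open>totient d\<close> factors \<open>y - z x\<close> with \<open>z\<close> on the
  unit circle.\<close>

lemma lattice_vector_lower_bound:
  fixes h x y :: int
  assumes p: "prime p" and d: "odd d" and hd: "[h ^ d = 1] (mod int p)"
    and h1: "\<not> [h = 1] (mod int p)" and yx: "[y = h * x] (mod int p)" and nz: "x \<noteq> 0 \<or> y \<noteq> 0"
  shows "int p \<le> (\<bar>x\<bar> + \<bar>y\<bar>) ^ totient d"
proof -
  have d0: "d > 0" using d by (auto intro: Nat.gr0I)
  have ip: "prime (int p)" using p by simp
  have S1: "\<bar>x\<bar> + \<bar>y\<bar> \<ge> 1" using nz by linarith
  \<comment> \<open>If \<open>p\<close> divides \<open>x\<close>, it also divides \<open>y\<close>,
    and a nonzero coordinate alone has absolute value at least \<open>p\<close>. Otherwise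
    \<open>x\<close> is nonzero and the quotient \<open>y / x\<close> makes sense.\<close>
  show ?thesis
  proof (cases "int p dvd x")
    case True
    with cong_dvd_iff[OF yx] have "int p dvd y" by simp
    have "int p \<le> \<bar>x\<bar> + \<bar>y\<bar>"
      using nz
    proof
      assume "x \<noteq> 0"
      then have "int p \<le> \<bar>x\<bar>" using True by (auto dest: dvd_imp_le_int)
      then show ?thesis by simp
    next
      assume "y \<noteq> 0"
      then have "int p \<le> \<bar>y\<bar>" using \<open>int p dvd y\<close> by (auto dest: dvd_imp_le_int)
      then show ?thesis by simp
    qed
    also have "\<dots> \<le> (\<bar>x\<bar> + \<bar>y\<bar>) ^ totient d"
      using S1 d0 by (intro self_le_power) auto
    finally show ?thesis .
  next
    case False
    then have x0: "x \<noteq> 0" by auto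
    have pos: "e > 0" if "e dvd d" for e using that d0 by (auto intro: Nat.gr0I)
    have "\<exists>v::int. poly (cyclotomic e) (of_int h) = of_int v" if "e dvd d" for e
    proof -
      have "e > 0" by (rule pos[OF that])
      then obtain G :: "int \<Rightarrow> int \<Rightarrow> int" where "\<forall>x y. x \<noteq> 0 \<longrightarrow> of_int (G y x) =
          of_int x ^ degree (cyclotomic e) * poly (cyclotomic e) (of_int y / of_int x)"
        using int_coeffs_homogenize[OF int_coeffs_cyclotomic] by blast
      from this[rule_format, of 1 h] show ?thesis by (intro exI[of _ "G h 1"]) simp
    qed
    then obtain v :: "nat \<Rightarrow> int" where
      v: "\<And>e. e dvd d \<Longrightarrow> poly (cyclotomic e) (of_int h) = of_int (v e)" by metis
    \<comment> \<open>The product of the \<open>v e\<close> is \<open>h ^ d - 1\<close>, a multiple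
      of \<open>p\<close>, so the prime \<open>p\<close> divides a single
      \<open>v e\<close>.\<close>
    have "of_int (\<Prod>e | e dvd d. v e) = poly (\<Prod>e | e dvd d. cyclotomic e) (of_int h)"
      by (simp add: poly_prod v)
    also have "\<dots> = of_int (h ^ d - 1)"
      by (simp add: prod_cyclotomic[OF d0] poly_monom)
    finally have "(\<Prod>e | e dvd d. v e) = h ^ d - 1" by (simp only: of_int_eq_iff)
    with hd have "int p dvd (\<Prod>e | e dvd d. v e)" by (simp add: cong_iff_dvd_diff)
    then obtain e where e: "e dvd d" "int p dvd v e"
      using prime_dvd_prod_iff[OF finite_divisors_nat[OF d0] ip, of v] by blast
    \<comment> \<open>The factor \<open>v 1 = h - 1\<close> is not divisible by \<open>p\<close>,
      and 2 does not divide the odd number \<open>d\<close>. Hence \<open>e > 2\<close>, and the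
      primitive roots involved are nonreal.\<close>
    have "e \<noteq> 1"
    proof
      assume "e = 1"
      moreover have "prim_roots 1 = {1}" by (auto simp: prim_roots_def)
      ultimately have "of_int (v e) = (of_int (h - 1) :: complex)"
        using v[of 1] by (simp add: poly_cyclotomic)
      then have "v e = h - 1" by (simp only: of_int_eq_iff)
      with e h1 show False by (simp add: cong_iff_dvd_diff)
    qed
    moreover have "odd e" using e d by auto
    then have "e \<noteq> 2" by auto
    ultimately have e2: "e > 2" using pos[OF e(1)] by linarith
    have e0: "e > 0" using e2 by simp
    let ?m = "degree (cyclotomic e)"
    obtain G :: "int \<Rightarrow> int \<Rightarrow> int" where
      G1': "\<forall>x y. x \<noteq> 0 \<longrightarrow> of_int (G y x) = of_int x ^ ?m * poly (cyclotomic e) (of_int y / of_int x)" and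
      G2': "\<forall>m x y h. [y = h * x] (mod m) \<longrightarrow> [G y x = x ^ ?m * G h 1] (mod m)"
      using int_coeffs_homogenize[OF int_coeffs_cyclotomic[OF e0]] by blast
    note G1 = G1'[rule_format] and G2 = G2'[rule_format]
    have "of_int (G h 1) = (of_int (v e) :: complex)" using G1[of 1 h] v[OF e(1)] by simp
    then have "G h 1 = v e" by (simp only: of_int_eq_iff)
    then have dvd: "int p dvd G y x"
      using cong_dvd_iff[OF G2[OF yx]] e(2) by simp
    have m: "?m = card (prim_roots e)" by (simp add: degree_cyclotomic card_prim_roots e0)
    have G: "of_int (G y x) = (\<Prod>z\<in>prim_roots e. of_int y - z * of_int x)"
    proof -
      have "of_int (G y x) = (\<Prod>z\<in>prim_roots e. of_int x * (of_int y / of_int x - z))"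
        by (simp add: G1[OF x0] m poly_cyclotomic prod.distrib)
      also have "\<dots> = (\<Prod>z\<in>prim_roots e. of_int y - z * of_int x)"
        using x0 by (intro prod.cong refl) (simp add: field_simps)
      finally show ?thesis .
    qed
    \<comment> \<open>A vanishing factor would make \<open>z\<close> a real number of modulus 1, so
      \<open>z ^ 2 = 1\<close>, against its order \<open>e > 2\<close>.\<close>
    have "of_int y - z * of_int x \<noteq> 0" if z: "z \<in> prim_roots e" for z
    proof
      assume "of_int y - z * of_int x = 0"
      then have "z = of_real (of_int y / of_int x)" using x0 by (simp add: field_simps)
      then obtain r where zr: "z = of_real r" by blast
      have "cmod z = 1" using e0 z by (rule norm_prim_root)
      then have "r ^ 2 = 1" using power2_abs[of r] by (simp add: zr)
      then have "z ^ 2 = 1" by (simp add: zr flip: of_real_power)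
      then show False using z e2 by (auto simp: prim_roots_def)
    qed
    then have "of_int (G y x) \<noteq> (0 :: complex)"
      unfolding G using finite_prim_roots[OF e0] by (simp add: prod_zero_iff)
    then have "G y x \<noteq> 0" by simp
    then have "int p \<le> \<bar>G y x\<bar>" using dvd by (auto dest: dvd_imp_le_int)
    also have "real_of_int \<bar>G y x\<bar> \<le> real_of_int ((\<bar>x\<bar> + \<bar>y\<bar>) ^ ?m)"
    proof -
      have "real_of_int \<bar>G y x\<bar> = cmod (of_int (G y x))" by simp
      also have "\<dots> = (\<Prod>z\<in>prim_roots e. cmod (of_int y - z * of_int x))"
        by (simp only: G prod_norm)
      also have "\<dots> \<le> (\<Prod>z\<in>prim_roots e. real_of_int (\<bar>x\<bar> + \<bar>y\<bar>))"
      proof (rule prod_mono, safe)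
        fix z assume "z \<in> prim_roots e"
        then have "cmod z = 1" using e0 by (intro norm_prim_root)
        then show "cmod (of_int y - z * of_int x) \<le> real_of_int (\<bar>x\<bar> + \<bar>y\<bar>)"
          using norm_triangle_ineq4[of "of_int y" "z * of_int x"] by (simp add: norm_mult)
      qed simp
      finally show ?thesis by (simp add: m)
    qed
    then have "\<bar>G y x\<bar> \<le> (\<bar>x\<bar> + \<bar>y\<bar>) ^ ?m" by (simp only: of_int_le_iff)
    \<comment> \<open>The exponent may grow from \<open>totient e\<close> to
      \<open>totient d\<close> because \<open>e dvd d\<close> and the base is at least 1.\<close>
    also have "\<dots> \<le> (\<bar>x\<bar> + \<bar>y\<bar>) ^ totient d"
      using S1 e d0 by (intro power_increasing) (auto simp: degree_cyclotomic e0 totient_dvd_mono)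
    finally show ?thesis .
  qed
qed

section \<open>The value at 1 of an odd L-function\<close>

text \<open>Differentiating both sides of \<open>Gamma y * Gamma (1 - y) = pi / sin (pi * y)\<close>
  at \<open>x\<close> and comparing gives the logarithmic derivative of the reflection
  formula.\<close>

lemma Digamma_reflection_real:
  fixes x :: real
  assumes "0 < x" "x < 1"
  shows "Digamma (1 - x) - Digamma x = pi * cot (pi * x)"
proof -
  have nonint: "y \<notin> \<int>\<^sub>\<le>\<^sub>0" if "y > 0" for y :: real
    using that by (auto elim!: nonpos_Ints_cases)
  have refl: "Gamma y * Gamma (1 - y) = pi / sin (pi * y)" for y :: real
    using Gamma_reflection_complex[of "of_real y"]
    by (metis (no_types, lifting) Gamma_complex_of_real of_real_1 of_real_diff of_real_divide
        of_real_eq_iff of_real_mult sin_of_real)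
  have s: "sin (pi * x) > 0" using assms by (intro sin_gt_zero) auto
  have "((\<lambda>y. Gamma y * Gamma (1 - y)) has_field_derivative
      Gamma x * Gamma (1 - x) * (Digamma x - Digamma (1 - x))) (at x)"
    using assms by (auto intro!: derivative_eq_intros nonint simp: algebra_simps)
  moreover have "((\<lambda>y. pi / sin (pi * y)) has_field_derivative
      - (pi / sin (pi * x)) * (pi * cot (pi * x))) (at x)"
    using s by (auto intro!: derivative_eq_intros simp: cot_def field_simps power2_eq_square)
  ultimately have "pi / sin (pi * x) * (Digamma x - Digamma (1 - x)) =
      - (pi / sin (pi * x)) * (pi * cot (pi * x))"
    unfolding refl by (rule DERIV_unique)
  then have "pi / sin (pi * x) * (Digamma (1 - x) - Digamma x) = pi / sin (pi * x) * (pi * cot (pi * x))"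
    by (simp add: algebra_simps)
  then show ?thesis using s by simp
qed

text \<open>Each Digamma value is a limit of \<open>ln N\<close> minus a sum of reciprocals. In the
  difference between \<open>1 - x\<close> and \<open>x\<close> the logarithms cancel.\<close>

lemma cot_partial_fractions_LIMSEQ:
  fixes x :: real
  assumes "0 < x" "x < 1"
  shows "(\<lambda>N. \<Sum>k<N. inverse (x + real k) - inverse (1 - x + real k)) \<longlonglongrightarrow> pi * cot (pi * x)"
proof -
  have "(\<lambda>N. (ln (real N) - (\<Sum>k<N. inverse (1 - x + real k))) -
      (ln (real N) - (\<Sum>k<N. inverse (x + real k)))) \<longlonglongrightarrow> Digamma (1 - x) - Digamma x"
    using Digamma_LIMSEQ[of "1 - x"] Digamma_LIMSEQ[of x] assms by (intro tendsto_diff) auto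
  then show ?thesis
    by (simp add: Digamma_reflection_real[OF assms] sum_subtractf)
qed

text \<open>An arbitrary partial sum exceeds the last complete block by fewer than \<open>m\<close>
  terms, and these tend to 0.\<close>

lemma sums_of_subsequence_LIMSEQ:
  fixes f :: "nat \<Rightarrow> 'a :: real_normed_vector"
  assumes m: "m > 0" and f: "f \<longlonglongrightarrow> 0" and lim: "(\<lambda>N. \<Sum>k<m * N. f k) \<longlonglongrightarrow> l"
  shows "f sums l"
proof -
  have div: "filterlim (\<lambda>n::nat. n div m) at_top sequentially"
    using m by (simp add: filterlim_at_top eventually_sequentially)
      (meson div_le_mono div_mult_self1_is_m le_trans less_eq_div_iff_mult_less_eq)
  \<comment> \<open>The incomplete block is written with exactly \<open>m\<close> guarded terms, so
    that a fixed number of null sequences is added.\<close>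
  have "(\<lambda>n. \<Sum>j<m. if m * (n div m) + j < n then f (m * (n div m) + j) else 0) \<longlonglongrightarrow> (\<Sum>j<m. 0)"
  proof (rule tendsto_sum)
    fix j
    have "filterlim (\<lambda>n. m * (n div m) + j) at_top sequentially"
      using m by (intro filterlim_at_top_mono[OF div] always_eventually allI) (metis le_add1 le_trans mult_le_mono1 nat_mult_1 Suc_leI One_nat_def)
    then have "(\<lambda>n. f (m * (n div m) + j)) \<longlonglongrightarrow> 0" by (rule filterlim_compose[OF f])
    then show "(\<lambda>n. if m * (n div m) + j < n then f (m * (n div m) + j) else 0) \<longlonglongrightarrow> 0"
      by (rule tendsto_0_le[where K = 1]) auto
  qed
  then have "(\<lambda>n. (\<Sum>k<m * (n div m). f k) +
      (\<Sum>j<m. if m * (n div m) + j < n then f (m * (n div m) + j) else 0)) \<longlonglongrightarrow> l + 0"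
    by (intro tendsto_add filterlim_compose[OF lim div]) simp
  moreover have "(\<Sum>k<m * (n div m). f k) +
      (\<Sum>j<m. if m * (n div m) + j < n then f (m * (n div m) + j) else 0) = (\<Sum>k<n. f k)" for n
  proof -
    let ?a = "m * (n div m)"
    have le: "?a \<le> n" by simp
    have "n - ?a < m" using m by (metis minus_mult_div_eq_mod mod_less_divisor)
    then have "(\<Sum>j<m. if ?a + j < n then f (?a + j) else 0) = (\<Sum>j<n - ?a. f (?a + j))"
      by (intro sum.mono_neutral_cong_right) auto
    moreover have "(\<Sum>j<n - ?a. f (?a + j)) = (\<Sum>k=?a..<n. f k)"
      by (intro sum.reindex_bij_witness[of _ "\<lambda>k. k - ?a" "\<lambda>j. ?a + j"]) auto
    moreover have "(\<Sum>k<n. f k) = (\<Sum>k<?a. f k) + (\<Sum>k=?a..<n. f k)"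
      using le by (subst sum.union_disjoint[symmetric]) (auto intro!: sum.cong simp del: times_div_less_eq_dividend)
    ultimately show ?thesis by simp
  qed
  ultimately show ?thesis by (simp add: sums_def)
qed

section \<open>Basic properties of Dirichlet characters and the formula for odd ones\<close>

lemma dirichlet_character_add_mult:
  assumes "dirichlet_character p \<psi>"
  shows "\<psi> (a + int p * k) = \<psi> a"
proof -
  have nat: "\<psi> (a + int p * int n) = \<psi> a" for a n
  proof (induction n)
    case (Suc n)
    have "\<psi> ((a + int p * int n) + int p) = \<psi> (a + int p * int n)"
      using assms by (simp only: dirichlet_character_def)
    with Suc show ?case by (simp add: algebra_simps)
  qed simp
  show ?thesis
  proof (cases "k \<ge> 0")
    case True
    then show ?thesis using nat[of a "nat k"] by simp
  next
    case False
    then show ?thesis using nat[of "a + int p * k" "nat (- k)"] by simp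
  qed
qed

lemma dirichlet_character_cong:
  assumes "dirichlet_character p \<psi>" "[a = b] (mod int p)"
  shows "\<psi> a = \<psi> b"
proof -
  from assms(2) obtain k where "b = a + int p * k" by (metis cong_iff_lin mult.commute)
  then show ?thesis using dirichlet_character_add_mult[OF assms(1)] by simp
qed

lemma dirichlet_character_mult: "dirichlet_character p \<psi> \<Longrightarrow> \<psi> (a * b) = \<psi> a * \<psi> b"
  by (simp add: dirichlet_character_def)

lemma dirichlet_character_power: "dirichlet_character p \<psi> \<Longrightarrow> \<psi> (a ^ n) = \<psi> a ^ n"
  by (induction n) (auto simp: dirichlet_character_def)

text \<open>By Euler's theorem the value is a root of unity.\<close>

lemma norm_dirichlet_character:
  assumes chi: "dirichlet_character p \<psi>" and p: "p > 1" and a: "coprime a (int p)"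
  shows "cmod (\<psi> a) = 1"
proof -
  have "[a ^ totient (nat \<bar>int p\<bar>) = 1] (mod int p)"
    using residues.euler_theorem[of "int p" a] p a by (simp add: residues_def)
  then have "\<psi> a ^ totient p = 1"
    using dirichlet_character_cong[OF chi] dirichlet_character_power[OF chi]
    by (metis abs_of_nat chi dirichlet_character_def nat_int)
  then show ?thesis
    using power_eq_1_iff[of "cmod (\<psi> a)" "totient p"] p by (auto simp flip: norm_power)
qed

lemma norm_dirichlet_character_le: 
  assumes "dirichlet_character p \<psi>" "p > 1"
  shows "cmod (\<psi> a) \<le> 1"
proof (cases "coprime a (int p)")
  case False
  then have "\<psi> a = 0" using assms by (auto simp: dirichlet_character_def)
  then show ?thesis by simp
qed (simp add: norm_dirichlet_character[OF assms])

text \<open>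
  Pairing \<open>a\<close> with \<open>p - a\<close> turns the blocks of length \<open>p\<close> of the series into the partial sums of
  the partial fraction expansion of the cotangent.
\<close>

lemma L_one_odd_character:
  assumes chi: "dirichlet_character p \<psi>" and odd: "\<psi> (- 1) = - 1" and p: "p > 1"
  shows "L_one \<psi> = of_real (pi / (2 * real p)) * (\<Sum>a=1..<int p. \<psi> a * of_real (cot (pi * of_int a / real p)))"
proof -
  let ?f = "\<lambda>n. \<psi> (int (Suc n)) / of_nat (Suc n)"
  have chi0: "\<psi> (int p) = 0" using chi p by (auto simp: dirichlet_character_def)
  \<comment> \<open>Index \<open>k\<close> of the shifted series carries the integer
    \<open>k + 1\<close>, so the first \<open>p * N\<close> terms run through \<open>N\<close> full
    residue systems \<open>1..p\<close>. The residue \<open>p\<close> contributes 0.\<close>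
  have block: "(\<Sum>k<p * N. ?f k) = (\<Sum>a=1..<int p. \<psi> a * (\<Sum>k<N. 1 / of_int (a + int p * int k)))" for N
  proof (induction N)
    case (Suc N)
    have "(\<Sum>k<p * Suc N. ?f k) = (\<Sum>k<p * N. ?f k) + (\<Sum>k=p * N..<p * N + p. ?f k)"
      by (subst sum.union_disjoint[symmetric]) (auto intro!: sum.cong)
    also have "(\<Sum>k=p * N..<p * N + p. ?f k) = (\<Sum>a=1..int p. \<psi> (a + int p * int N) / of_int (a + int p * int N))"
      by (rule sum.reindex_bij_witness[of _ "\<lambda>a. nat (a + int p * int N) - 1" "\<lambda>k. int (Suc k) - int p * int N"])
         (auto simp: nat_add_distrib nat_mult_distrib algebra_simps of_nat_diff nat_diff_distrib zle_int simp flip: of_nat_mult)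
    also have "\<dots> = (\<Sum>a=1..int p. \<psi> a / of_int (a + int p * int N))"
      by (simp only: dirichlet_character_add_mult[OF chi])
    also have "{1..int p} = insert (int p) {1..<int p}" using p by auto
    also have "(\<Sum>a\<in>insert (int p) {1..<int p}. \<psi> a / of_int (a + int p * int N)) =
        (\<Sum>a=1..<int p. \<psi> a / of_int (a + int p * int N))"
      by (subst sum.insert) (auto simp: chi0)
    finally show ?case by (simp only: Suc.IH sum.lessThan_Suc sum.distrib distrib_left times_divide_eq_right mult_1_right)
  qed simp
  define S where "S N = (\<Sum>k<p * N. ?f k)" for N
  \<comment> \<open>The block sum is averaged with its image under
    \<open>a \<rightarrow> p - a\<close>, whence the denominator 2. Oddness turns the image into a
    difference, and dividing by \<open>p\<close> moves \<open>a / p\<close> into the interval where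
    the cotangent expansion holds.\<close>
  have half: "S N = (\<Sum>a=1..<int p. \<psi> a * of_real ((\<Sum>k<N. inverse (of_int a / real p + real k) -
      inverse (1 - of_int a / real p + real k)) / (2 * real p)))" for N
  proof -
    have neg: "\<psi> (int p - a) = - \<psi> a" for a
      using dirichlet_character_add_mult[OF chi, of "-1 * a" 1] dirichlet_character_mult[OF chi, of "-1" a]
      by (simp add: odd)
    have "S N = (\<Sum>a=1..<int p. \<psi> (int p - a) * (\<Sum>k<N. 1 / of_int (int p - a + int p * int k)))"
      unfolding S_def block
      by (rule sum.reindex_bij_witness[of _ "\<lambda>a. int p - a" "\<lambda>a. int p - a"]) auto
    then have "S N = (\<Sum>a=1..<int p. - \<psi> a * (\<Sum>k<N. 1 / of_int (int p - a + int p * int k)))"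
      by (simp only: neg)
    then have "2 * S N = (\<Sum>a=1..<int p. \<psi> a * ((\<Sum>k<N. 1 / of_int (a + int p * int k)) -
        (\<Sum>k<N. 1 / of_int (int p - a + int p * int k))))"
      using block[of N] by (simp add: S_def sum_negf sum_subtractf right_diff_distrib)
    also have "\<dots> = (\<Sum>a=1..<int p. \<psi> a * of_real ((\<Sum>k<N. inverse (of_int a / real p + real k) -
      inverse (1 - of_int a / real p + real k)) / real p))"
    proof (intro sum.cong refl arg_cong2[where f = "(*)"])
      fix a assume a: "a \<in> {1..<int p}"
      have inv: "inverse x / real p = 1 / (x * real p)" for x by (simp add: inverse_eq_divide)
      have "(of_int a / real p + real k) * real p = of_int (a + int p * int k)" for k
        using p by (simp add: field_simps)
      then have "inverse (of_int a / real p + real k) / real p = 1 / of_int (a + int p * int k)" for k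
        by (simp only: inv)
      moreover have "(1 - of_int a / real p + real k) * real p = of_int (int p - a + int p * int k)" for k
        using p by (simp add: field_simps)
      then have "inverse (1 - of_int a / real p + real k) / real p = 1 / of_int (int p - a + int p * int k)" for k
        by (simp only: inv)
      ultimately show "(\<Sum>k<N. 1 / of_int (a + int p * int k)) -
        (\<Sum>k<N. 1 / of_int (int p - a + int p * int k)) = complex_of_real ((\<Sum>k<N. inverse (of_int a / real p + real k) -
      inverse (1 - of_int a / real p + real k)) / real p)"
        by (simp only: sum_subtractf diff_divide_distrib sum_divide_distrib) simp
    qed
    finally have "S N = (\<Sum>a=1..<int p. \<psi> a * of_real ((\<Sum>k<N. inverse (of_int a / real p + real k) -
      inverse (1 - of_int a / real p + real k)) / real p)) / 2"
      by (metis nonzero_mult_div_cancel_left zero_neq_numeral)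
    also have "\<dots> = (\<Sum>a=1..<int p. \<psi> a * of_real ((\<Sum>k<N. inverse (of_int a / real p + real k) -
      inverse (1 - of_int a / real p + real k)) / (2 * real p)))"
      by (subst sum_divide_distrib, intro sum.cong refl) (simp only: of_real_divide of_real_mult times_divide_eq_right divide_divide_eq_left of_real_numeral mult.commute)
    finally show ?thesis .
  qed
  have "S \<longlonglongrightarrow> (\<Sum>a=1..<int p. \<psi> a * of_real (pi * cot (pi * (of_int a / real p)) / (2 * real p)))"
    unfolding half using p
    by (intro tendsto_sum tendsto_mult tendsto_const tendsto_of_real tendsto_divide cot_partial_fractions_LIMSEQ) auto
  then have lim: "(\<lambda>N. \<Sum>k<p * N. ?f k) \<longlonglongrightarrow> (\<Sum>a=1..<int p. \<psi> a * of_real (pi * cot (pi * (of_int a / real p)) / (2 * real p)))"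
    by (simp only: S_def[abs_def])
  \<comment> \<open>Convergence along multiples of \<open>p\<close> extends to all partial sums,
    since the term at \<open>n\<close> is at most \<open>1 / (n + 1)\<close> in modulus.\<close>
  have "?f sums (\<Sum>a=1..<int p. \<psi> a * of_real (pi * cot (pi * (of_int a / real p)) / (2 * real p)))"
  proof (rule sums_of_subsequence_LIMSEQ[OF _ _ lim])
    show "p > 0" using p by simp
    have "(\<lambda>n. 1 / real (Suc n)) \<longlonglongrightarrow> 0" using LIMSEQ_inverse_real_of_nat by (simp add: inverse_eq_divide)
    then show "?f \<longlonglongrightarrow> 0"
    proof (rule tendsto_0_le[where K = 1], intro always_eventually allI)
      fix n
      show "norm (?f n) \<le> norm (1 / real (Suc n)) * 1"
        using norm_dirichlet_character_le[OF chi p, of "int (Suc n)"]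
        by (simp add: norm_divide divide_right_mono del: of_nat_Suc)
    qed
  qed
  then show ?thesis
    unfolding L_one_def by (simp add: sums_iff sum_distrib_left algebra_simps)
qed

section \<open>Orthogonality and the reduction to cotangent sums\<close>

text \<open>A primitive root provides \<open>g\<close>. Together the two properties make the index
  of a unit well defined modulo \<open>p - 1\<close>, which is how characters are constructed
  below.\<close>

lemma prime_discrete_log:
  assumes p: "prime p"
  obtains g :: int where "\<And>a. coprime a (int p) \<Longrightarrow> \<exists>i. [g ^ i = a] (mod int p)"
    "\<And>i j. [g ^ i = g ^ j] (mod int p) \<longleftrightarrow> [i = j] (mod (p - 1))"
proof -
  obtain g where g: "residue_primroot p g"
    using prime_primitive_root_exists[of p] p prime_gt_1_nat[OF p] by blast
  have p1: "p > 1" using p by (rule prime_gt_1_nat)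
  show ?thesis
  proof
    fix a :: int assume a: "coprime a (int p)"
    define b where "b = nat (a mod int p)"
    have b: "int b = a mod int p" using p1 by (simp add: b_def)
    have "coprime (int b) (int p)" using a p1 by (simp add: b)
    then have "coprime b p" by simp
    moreover have "b < p" using b p1 by (metis of_nat_0_less_iff of_nat_less_iff pos_mod_bound less_trans zero_less_one)
    ultimately have "b \<in> totatives p" using p1 by (auto simp: totatives_def intro!: Nat.gr0I)
    then have "b \<in> (\<lambda>i. g ^ i mod p) ` {..<totient p}"
      using bij_betw_imp_surj_on[OF residue_primroot_is_generator[OF p1 g]] by simp
    then obtain i where "g ^ i mod p = b" by auto
    then have "int g ^ i mod int p = a mod int p" using b by (metis of_nat_mod of_nat_power)
    then show "\<exists>i. [int g ^ i = a] (mod int p)" unfolding unique_euclidean_semiring_class.cong_def by blast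
  next
    fix i j
    have "[int g ^ i = int g ^ j] (mod int p) \<longleftrightarrow> [g ^ i = g ^ j] (mod p)"
      by (simp flip: cong_int_iff)
    also have "\<dots> \<longleftrightarrow> [i = j] (mod ord p g)"
      using g by (intro order_divides_expdiff) (auto simp: residue_primroot_def)
    finally show "[int g ^ i = int g ^ j] (mod int p) \<longleftrightarrow> [i = j] (mod (p - 1))"
      using g p by (simp add: residue_primroot_def totient_prime)
  qed
qed

text \<open>The character sends \<open>g ^ i\<close> to
  \<open>exp (2 pi \<i> d i / (p - 1))\<close>. It is the \<open>d\<close>-th power of a faithful
  character, hence trivial at \<open>a\<close> exactly when \<open>a ^ d\<close> is 1.\<close>

lemma exists_character_with_kernel:
  assumes p: "prime p"
  obtains \<psi> where "dirichlet_character p \<psi>"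
    "\<And>a. coprime a (int p) \<Longrightarrow> \<psi> a = 1 \<longleftrightarrow> [a ^ d = 1] (mod int p)"
proof -
  obtain g where gen: "\<And>a. coprime a (int p) \<Longrightarrow> \<exists>i. [g ^ i = a] (mod int p)"
    and exp: "\<And>i j. [g ^ i = g ^ j] (mod int p) \<longleftrightarrow> [i = j] (mod (p - 1))"
    using prime_discrete_log[OF p] by blast
  have p1: "p - 1 \<ge> 1" using prime_gt_1_nat[OF p] by simp
  define e where "e j = exp (2 * of_real pi * \<i> * of_nat j / of_nat (p - 1))" for j
  have e1: "e j = 1 \<longleftrightarrow> p - 1 dvd j" for j
    unfolding e_def using complex_root_unity_eq_1[OF p1] by simp
  have eadd: "e (i + j) = e i * e j" for i j
    by (simp add: e_def algebra_simps add_divide_distrib exp_add)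
  have econg: "e i = e j" if "[i = j] (mod (p - 1))" for i j
  proof -
    have "e i = e j" if le: "i \<le> j" and c: "[i = j] (mod (p - 1))" for i j
    proof -
      have "p - 1 dvd j - i" using c le by (metis cong_altdef_nat cong_sym)
      then have "e (i + (j - i)) = e i" by (simp add: eadd e1)
      then show ?thesis using le by simp
    qed
    from this[of i j] this[of j i] show ?thesis using that by (metis cong_sym nat_le_linear)
  qed
  define ind where "ind a = (SOME i. [g ^ i = a] (mod int p))" for a
  have ind: "[g ^ ind a = a] (mod int p)" if "coprime a (int p)" for a
    unfolding ind_def using gen[OF that] by (rule someI_ex)
  define \<psi> where "\<psi> a = (if coprime a (int p) then e (d * ind a) else 0)" for a
  \<comment> \<open>The index is picked by a choice operator. Any other exponent representing
    \<open>a\<close> gives the same value, as the two agree modulo \<open>p - 1\<close>.\<close>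
  have psi: "\<psi> a = e (d * i)" if "coprime a (int p)" "[g ^ i = a] (mod int p)" for a i
  proof -
    have "[g ^ ind a = g ^ i] (mod int p)" using ind[OF that(1)] that(2) by (metis cong_sym cong_trans)
    then have "[d * ind a = d * i] (mod (p - 1))" unfolding exp by (rule cong_scalar_left)
    then show ?thesis using that(1) econg by (simp add: \<psi>_def)
  qed
  show ?thesis
  proof
    show "dirichlet_character p \<psi>"
      unfolding dirichlet_character_def
    proof (intro conjI allI)
      have "\<psi> 1 = e (d * 0)" by (rule psi) auto
      then show "\<psi> 1 = 1" by (simp add: e_def)
    next
      fix a b
      show "\<psi> (a * b) = \<psi> a * \<psi> b"
      proof (cases "coprime (a * b) (int p)")
        case True
        then have ab: "coprime a (int p)" "coprime b (int p)" by auto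
        have "[g ^ (ind a + ind b) = a * b] (mod int p)"
          unfolding power_add by (intro cong_mult ind ab)
        from psi[OF True this] show ?thesis
          using psi[OF ab(1) ind[OF ab(1)]] psi[OF ab(2) ind[OF ab(2)]] by (simp add: algebra_simps eadd)
      next
        case False
        then show ?thesis by (auto simp: \<psi>_def)
      qed
    next
      fix a
      show "\<psi> (a + int p) = \<psi> a"
      proof (cases "coprime a (int p)")
        case True
        have "[g ^ ind a = a + int p] (mod int p)"
          using ind[OF True] by (simp only: unique_euclidean_semiring_class.cong_def mod_add_self2)
        moreover have "coprime (a + int p) (int p)" using True by (simp add: coprime_iff_gcd_eq_1)
        ultimately show ?thesis using psi psi[OF True ind[OF True]] by simp
      next
        case False
        then have "\<not> coprime (a + int p) (int p)" by (simp add: coprime_iff_gcd_eq_1)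
        with False show ?thesis by (simp add: \<psi>_def)
      qed
    next
      fix a
      show "\<psi> a = 0 \<longleftrightarrow> \<not> coprime a (int p)" by (simp add: \<psi>_def e_def)
    qed
  next
    fix a assume a: "coprime a (int p)"
    have "\<psi> a = 1 \<longleftrightarrow> [d * ind a = 0] (mod (p - 1))"
      using a by (simp add: \<psi>_def e1 cong_0_iff)
    also have "\<dots> \<longleftrightarrow> [g ^ (d * ind a) = 1] (mod int p)" using exp[of "d * ind a" 0] by simp
    also have "\<dots> \<longleftrightarrow> [a ^ d = 1] (mod int p)"
    proof -
      have "[g ^ (d * ind a) = a ^ d] (mod int p)"
        using cong_pow[OF ind[OF a], of d] by (simp add: power_mult mult.commute flip: power_mult)
      then show ?thesis by (metis cong_sym cong_trans)
    qed
    finally show "\<psi> a = 1 \<longleftrightarrow> [a ^ d = 1] (mod int p)" .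
  qed
qed

text \<open>These facts carry the group structure over to integers and congruences; the last one is
  Lagrange's theorem.\<close>

lemma
  assumes p: "prime p" and H: "subgroup H (unit_group_mod p)"
  shows subgroup_subset: "H \<subseteq> {1..<int p}"
    and one_in_subgroup: "1 \<in> H"
    and subgroup_power_card: "\<And>h. h \<in> H \<Longrightarrow> [h ^ card H = 1] (mod int p)"
proof -
  interpret residues_prime p "residue_ring (int p)"
    by unfold_locales (use p in auto)
  let ?R = "residue_ring (int p)"
  let ?U = "units_of ?R"
  have H': "subgroup H ?U" using H by (simp add: unit_group_mod_def)
  interpret U: group ?U by (rule units_group)
  show sub: "H \<subseteq> {1..<int p}"
    using subgroup.subset[OF H'] res_prime_units_eq prime_gt_0_nat[OF p]
    by (auto simp: units_of_def of_nat_diff)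
  show "1 \<in> H" using subgroup.one_closed[OF H'] by (simp add: units_of_def res_one_eq)
  fix h assume h: "h \<in> H"
  interpret H: group "?U\<lparr>carrier := H\<rparr>" by (rule subgroup.subgroup_is_group[OF H' U.is_group])
  have "h [^]\<^bsub>?U\<lparr>carrier := H\<rparr>\<^esub> Coset.order (?U\<lparr>carrier := H\<rparr>) = \<one>\<^bsub>?U\<lparr>carrier := H\<rparr>\<^esub>"
    using h by (intro H.pow_order_eq_1) simp
  then have "h [^]\<^bsub>?U\<^esub> card H = \<one>\<^bsub>?R\<^esub>"
    unfolding U.nat_pow_consistent[symmetric] Coset.order_def by (simp add: units_of_one)
  moreover have "h [^]\<^bsub>?U\<^esub> card H = h [^]\<^bsub>?R\<^esub> card H"
    using h subgroup.subset[OF H'] by (intro units_of_pow) (auto simp: units_of_def)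
  moreover have "h [^]\<^bsub>?R\<^esub> card H = h ^ card H mod int p"
    using pow_cong[of h "card H"] h sub by auto
  ultimately show "[h ^ card H = 1] (mod int p)"
    using prime_gt_1_nat[OF p] by (simp add: unique_euclidean_semiring_class.cong_def res_one_eq)
qed

text \<open>The elements of \<open>H\<close> are roots of \<open>X ^ card H - 1\<close> modulo the
  prime \<open>p\<close>. This polynomial has at most \<open>card H\<close> roots, so
  \<open>H\<close> consists of all of them.\<close>

lemma mem_subgroup_iff:
  assumes p: "prime p" and H: "subgroup H (unit_group_mod p)"
  shows "a mod int p \<in> H \<longleftrightarrow> [a ^ card H = 1] (mod int p)"
proof -
  note sub = subgroup_subset[OF p H]
  have fin: "finite H" using sub by (rule finite_subset) simp
  have card0: "card H > 0" using one_in_subgroup[OF p H] fin card_gt_0_iff by blast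
  let ?A = "{x\<in>{..<p}. [x ^ card H = 1] (mod p)}"
  have "H = int ` ?A"
  proof (rule card_seteq)
    show "finite (int ` ?A)" by simp
    show "H \<subseteq> int ` ?A"
    proof
      fix h assume h: "h \<in> H"
      then have h': "h = int (nat h)" "nat h < p" using sub by force+
      have "[int (nat h) ^ card H = 1] (mod int p)" using subgroup_power_card[OF p H h] h' by simp
      then have "[nat h ^ card H = 1] (mod p)" by (simp flip: cong_int_iff)
      with h' show "h \<in> int ` ?A" by blast
    qed
    have "card ?A \<le> card H" using p card0 by (intro roots_mod_prime_bound) auto
    then show "card (int ` ?A) \<le> card H" by (simp add: card_image)
  qed
  moreover have "a mod int p \<in> int ` ?A \<longleftrightarrow> [a ^ card H = 1] (mod int p)"
  proof -
    have n: "int (nat (a mod int p)) = a mod int p" using prime_gt_0_nat[OF p] by simp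
    have "nat (a mod int p) < p" using n prime_gt_0_nat[OF p]
      by (metis of_nat_0_less_iff of_nat_less_iff pos_mod_bound)
    then have "a mod int p \<in> int ` ?A \<longleftrightarrow> [nat (a mod int p) ^ card H = 1] (mod p)"
      using n by (auto simp: image_iff)
    also have "\<dots> \<longleftrightarrow> [(a mod int p) ^ card H = 1] (mod int p)"
      using cong_int_iff[of "nat (a mod int p) ^ card H" 1 p] n by simp
    also have "\<dots> \<longleftrightarrow> [a ^ card H = 1] (mod int p)" by (simp add: unique_euclidean_semiring_class.cong_def power_mod)
    finally show ?thesis .
  qed
  ultimately show ?thesis by simp
qed

text \<open>A character is determined by its values on one residue system, and each value is 0 or a
  root of unity of order dividing \<open>totient p\<close>.\<close>

lemma finite_odd_chars:
  assumes "prime p"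
  shows "finite (odd_chars p H)"
proof (rule finite_subset)
  let ?V = "insert 0 {z::complex. z ^ totient p = 1}"
  let ?F = "{0..<int p} \<rightarrow>\<^sub>E ?V"
  have p: "p > 1" using assms by (rule prime_gt_1_nat)
  show "odd_chars p H \<subseteq> (\<lambda>f a. f (a mod int p)) ` ?F"
  proof
    fix \<psi> assume "\<psi> \<in> odd_chars p H"
    then have psi: "dirichlet_character p \<psi>" by (simp add: odd_chars_def)
    have "\<psi> a \<in> ?V" for a
    proof (cases "coprime a (int p)")
      case True
      then have "[a ^ totient (nat \<bar>int p\<bar>) = 1] (mod int p)"
        using residues.euler_theorem[of "int p" a] p by (simp add: residues_def)
      then have "\<psi> (a ^ totient p) = \<psi> 1" by (intro dirichlet_character_cong[OF psi]) simp
      then have "\<psi> a ^ totient p = 1"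
        using psi by (simp only: dirichlet_character_power[OF psi]) (simp add: dirichlet_character_def)
      then show ?thesis by simp
    next
      case False
      then show ?thesis using psi by (simp add: dirichlet_character_def)
    qed
    moreover have "\<psi> = (\<lambda>a. restrict \<psi> {0..<int p} (a mod int p))"
    proof
      fix a
      show "\<psi> a = restrict \<psi> {0..<int p} (a mod int p)"
        using p dirichlet_character_cong[OF psi, of a "a mod int p"] by (simp add: unique_euclidean_semiring_class.cong_def)
    qed
    moreover from calculation(1) have "restrict \<psi> {0..<int p} \<in> ?F" by simp
    ultimately show "\<psi> \<in> (\<lambda>f a. f (a mod int p)) ` ?F" by (intro image_eqI)
  qed
  have "totient p > 0" using p by simp
  then have "finite {z::complex. z ^ totient p = 1}" by (intro finite_roots_unity) linarith
  then show "finite ((\<lambda>f a. f (a mod int p)) ` ?F)" by (intro finite_imageI finite_PiE) auto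
qed

text \<open>The construction above with exponent \<open>card H\<close> has kernel exactly
  \<open>H\<close>. It is odd, since \<open>(- 1) ^ card H = - 1\<close> differs from 1 modulo
  \<open>p \<ge> 3\<close>. It shows that \<open>odd_chars p H\<close> is nonempty and separates
  residues in the orthogonality relation.\<close>

lemma odd_character_with_kernel:
  assumes p: "prime p" "p \<ge> 3" and H: "subgroup H (unit_group_mod p)" and odd: "odd (card H)"
  obtains \<psi> where "\<psi> \<in> odd_chars p H" "\<And>a. coprime a (int p) \<Longrightarrow> \<psi> a = 1 \<longleftrightarrow> a mod int p \<in> H"
proof -
  obtain \<psi> where psi: "dirichlet_character p \<psi>"
    and ker: "\<And>a. coprime a (int p) \<Longrightarrow> \<psi> a = 1 \<longleftrightarrow> [a ^ card H = 1] (mod int p)"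
    using exists_character_with_kernel[OF p(1)] by blast
  have cop: "coprime h (int p)" if "h \<in> H" for h
    using subgroup_subset[OF p(1) H] that p(1)
    by (metis atLeastLessThan_iff coprime_commute prime_imp_coprime prime_nat_int_transfer
        subset_iff zdvd_not_zless zero_less_one order_less_le_trans)
  have "\<psi> (- 1) * \<psi> (- 1) = \<psi> ((- 1) * (- 1))"
    by (simp only: dirichlet_character_mult[OF psi])
  also have "\<dots> = 1" using psi by (simp add: dirichlet_character_def)
  finally have "\<psi> (- 1) = 1 \<or> \<psi> (- 1) = - 1" by (simp add: square_eq_1_iff)
  moreover have "\<psi> (- 1) \<noteq> 1"
  proof
    assume "\<psi> (- 1) = 1"
    then have "[(- 1) ^ card H = 1] (mod int p)" using ker[of "- 1"] by simp
    then have "int p dvd 2" using odd by (simp add: cong_iff_dvd_diff)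
    then show False using p(2) by (auto dest: zdvd_imp_le)
  qed
  ultimately have "\<psi> (- 1) = - 1" by simp
  then show ?thesis
    using psi ker mem_subgroup_iff[OF p(1) H] cop subgroup_power_card[OF p(1) H]
    by (intro that[of \<psi>]) (auto simp: odd_chars_def)
qed

text \<open>On \<open>H\<close> and on \<open>- H\<close> the summands are constantly 1 or
  constantly - 1. Elsewhere a permutation of the characters multiplies the sum by a number other
  than 1, so the sum vanishes.\<close>

lemma sum_odd_chars:
  assumes p: "prime p" "p \<ge> 3" and H: "subgroup H (unit_group_mod p)" and odd: "odd (card H)"
    and l: "coprime l (int p)"
  shows "(\<Sum>\<psi>\<in>odd_chars p H. \<psi> l) =
    of_nat (card (odd_chars p H)) * (of_bool (l mod int p \<in> H) - of_bool (- l mod int p \<in> H))"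
proof -
  let ?X = "odd_chars p H"
  obtain \<omega> where w: "\<omega> \<in> ?X" and ker: "\<And>a. coprime a (int p) \<Longrightarrow> \<omega> a = 1 \<longleftrightarrow> a mod int p \<in> H"
    using odd_character_with_kernel[OF p H odd] by blast
  have dir: "dirichlet_character p \<psi>" if "\<psi> \<in> ?X" for \<psi> using that by (simp add: odd_chars_def)
  have neg: "\<psi> (- a) = - \<psi> a" if "\<psi> \<in> ?X" for \<psi> a
    using dirichlet_character_mult[OF dir[OF that], of "- 1" a] that by (simp add: odd_chars_def)
  have onH: "\<psi> a = 1" if "\<psi> \<in> ?X" "a mod int p \<in> H" for \<psi> a
    using dirichlet_character_cong[OF dir[OF that(1)], of a "a mod int p"] that
    by (simp add: odd_chars_def unique_euclidean_semiring_class.cong_def)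
  consider "l mod int p \<in> H" | "- l mod int p \<in> H" | "l mod int p \<notin> H" "- l mod int p \<notin> H" by blast
  then show ?thesis
  proof cases
    case 1
    then have "- l mod int p \<notin> H" using onH[OF w, of l] onH[OF w, of "- l"] neg[OF w, of l] by auto
    moreover have "(\<Sum>\<psi>\<in>?X. \<psi> l) = (\<Sum>\<psi>\<in>?X. 1)"
      by (rule sum.cong) (use onH 1 in blast)+
    ultimately show ?thesis using 1 by simp
  next
    case 2
    then have "l mod int p \<notin> H" using onH[OF w, of l] onH[OF w, of "- l"] neg[OF w, of l] by auto
    moreover have "\<psi> l = - 1" if "\<psi> \<in> ?X" for \<psi>
      using onH[OF that 2] neg[OF that, of l] by (simp add: minus_equation_iff)
    then have "(\<Sum>\<psi>\<in>?X. \<psi> l) = (\<Sum>\<psi>\<in>?X. - 1)"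
      by (rule sum.cong[OF refl])
    ultimately show ?thesis using 2 by simp
  next
    case 3
    \<comment> \<open>The square is used because \<open>\<omega>\<close> alone would destroy
      oddness, while \<open>\<omega> ^ 2\<close> is even and trivial on \<open>H\<close>. The exact
      kernel rules out \<open>\<omega> l = 1\<close> and, applied to \<open>- l\<close>, also
      \<open>\<omega> l = - 1\<close>.\<close>
    let ?T = "\<lambda>\<psi> a. \<omega> a ^ 2 * \<psi> a"
    have "?T ` ?X \<subseteq> ?X"
      using w by (auto simp: odd_chars_def dirichlet_character_def power_mult_distrib)
    moreover have "inj_on ?T ?X"
    proof (rule inj_onI, rule ext)
      fix \<psi> \<psi>' a assume *: "\<psi> \<in> ?X" "\<psi>' \<in> ?X" "?T \<psi> = ?T \<psi>'"
      have zero: "\<psi> a = 0 \<longleftrightarrow> \<not> coprime a (int p)" if "\<psi> \<in> ?X" for \<psi>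
        using dir[OF that] by (simp add: dirichlet_character_def)
      show "\<psi> a = \<psi>' a"
        using fun_cong[OF *(3), of a] zero[OF w] zero[OF *(1)] zero[OF *(2)]
        by (cases "coprime a (int p)") auto
    qed
    ultimately have "?T ` ?X = ?X" using endo_inj_surj[OF finite_odd_chars[OF p(1)]] by blast
    then have "(\<Sum>\<psi>\<in>?X. \<psi> l) = (\<Sum>\<psi>\<in>?X. ?T \<psi> l)"
      using \<open>inj_on ?T ?X\<close> sum.reindex[of ?T ?X "\<lambda>\<psi>. \<psi> l"] by simp
    also have "\<dots> = \<omega> l ^ 2 * (\<Sum>\<psi>\<in>?X. \<psi> l)" by (simp add: sum_distrib_left)
    finally have "(\<Sum>\<psi>\<in>?X. \<psi> l) = 0 \<or> \<omega> l ^ 2 = 1" by auto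
    moreover have "\<omega> l \<noteq> 1" using ker[OF l] 3 by simp
    moreover have "\<omega> l \<noteq> - 1" using ker[of "- l"] l 3 neg[OF w, of l] by auto
    ultimately have "(\<Sum>\<psi>\<in>?X. \<psi> l) = 0" by (auto simp: power2_eq_1_iff)
    then show ?thesis using 3 by simp
  qed
qed

section \<open>Cotangent sums over residues and the mean square\<close>

definition cot_res :: "nat \<Rightarrow> int \<Rightarrow> real" where
  "cot_res p x = cot (pi * of_int x / real p)"

text \<open>For \<open>a\<close> and \<open>b\<close> prime to a prime \<open>p\<close> this is
  \<open>4 p\<close> times the Dedekind sum \<open>s(c, p)\<close>, where
  \<open>a c \<equiv> b\<close> modulo \<open>p\<close>.\<close>

definition cot_sum :: "nat \<Rightarrow> int \<Rightarrow> int \<Rightarrow> real" where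
  "cot_sum p a b = (\<Sum>n=1..<int p. cot_res p (a * n) * cot_res p (b * n))"

lemma cot_res_cong:
  assumes p: "p > 0" and "[x = y] (mod int p)"
  shows "cot_res p x = cot_res p y"
proof -
  from assms(2) obtain k where k: "y = x + int p * k" by (metis cong_iff_lin mult.commute)
  have "pi * of_int y / real p = pi * of_int x / real p + of_int k * pi"
    using p by (simp add: k field_simps)
  moreover have s: "sin (of_int k * pi) = (0::real)" by (subst sin_zero_iff_int2) blast
  moreover have "cos (of_int k * pi) \<noteq> (0::real)" using sin_cos_squared_add[of "of_int k * pi :: real"] s by auto
  ultimately show ?thesis
    by (simp add: cot_res_def cot_def sin_add cos_add)
qed

lemma cot_res_minus: "cot_res p (- x) = - cot_res p x"
  by (simp add: cot_res_def cot_def)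

lemma coprime_prime_residue:
  assumes "prime p" "a \<in> {1..<int p}"
  shows "coprime a (int p)"
proof -
  have "\<not> int p dvd a" using assms(2) by (auto simp: zdvd_not_zless)
  then have "coprime (int p) a" using assms(1) by (intro prime_imp_coprime) auto
  then show ?thesis by (simp add: coprime_commute)
qed

lemma bij_betw_mult_mod:
  assumes p: "prime p" and q: "coprime q (int p)"
  shows "bij_betw (\<lambda>n. q * n mod int p) {1..<int p} {1..<int p}"
proof -
  have p0: "int p > 0" using prime_gt_0_nat[OF p] by simp
  have inj: "inj_on (\<lambda>n. q * n mod int p) {1..<int p}"
  proof (rule inj_onI)
    fix m n assume *: "m \<in> {1..<int p}" "n \<in> {1..<int p}" "q * m mod int p = q * n mod int p"
    then have "[q * m = q * n] (mod int p)" by (simp add: unique_euclidean_semiring_class.cong_def)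
    then have "[m = n] (mod int p)" using q by (simp add: cong_mult_lcancel)
    then show "m = n" using * by (simp add: unique_euclidean_semiring_class.cong_def)
  qed
  moreover have "(\<lambda>n. q * n mod int p) ` {1..<int p} \<subseteq> {1..<int p}"
  proof safe
    fix n assume "n \<in> {1..<int p}"
    then have "coprime (q * n) (int p)" using q coprime_prime_residue[OF p] by simp
    then have "\<not> int p dvd q * n"
      using prime_gt_1_nat[OF p] by (metis coprime_absorb_right not_prime_unit of_nat_1 p prime_nat_int_transfer)
    then have "q * n mod int p \<noteq> 0" by (simp add: dvd_eq_mod_eq_0)
    moreover have "q * n mod int p \<ge> 0" "q * n mod int p < int p" using p0 by simp_all
    ultimately show "q * n mod int p \<in> {1..<int p}" by auto
  qed
  ultimately show ?thesis by (simp add: bij_betw_def endo_inj_surj)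
qed

lemma sum_mult_residues:
  fixes f :: "int \<Rightarrow> 'a :: comm_monoid_add"
  assumes "prime p" "coprime q (int p)" and f: "\<And>x y. [x = y] (mod int p) \<Longrightarrow> f x = f y"
  shows "(\<Sum>n=1..<int p. f (q * n)) = (\<Sum>n=1..<int p. f n)"
proof -
  have "(\<Sum>n=1..<int p. f (q * n)) = (\<Sum>n=1..<int p. f (q * n mod int p))"
    by (intro sum.cong refl f) (simp add: unique_euclidean_semiring_class.cong_def)
  also have "\<dots> = (\<Sum>n=1..<int p. f n)"
    by (rule sum.reindex_bij_betw[OF bij_betw_mult_mod[OF assms(1,2)]])
  finally show ?thesis .
qed

text \<open>Permuting residues absorbs the twists by \<open>a\<close> and \<open>b\<close> into the
  arguments of the cotangents. In the remaining double sum the substitution \<open>m = n l\<close>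
  cancels \<open>\<psi> n\<close> against its conjugate and leaves \<open>\<psi> l\<close>.\<close>

lemma twisted_square_expand:
  assumes p: "prime p" and psi: "dirichlet_character p \<psi>"
    and a: "coprime a (int p)" and b: "coprime b (int p)"
  defines "T \<equiv> \<Sum>n=1..<int p. \<psi> n * of_real (cot_res p n)"
  shows "\<psi> a * cnj (\<psi> b) * of_real ((cmod T)\<^sup>2) = (\<Sum>l=1..<int p. \<psi> l * of_real (cot_sum p a (b * l)))"
proof -
  have p0: "p > 0" and p1: "p > 1" using prime_gt_1_nat[OF p] by simp_all
  let ?c = "\<lambda>x. complex_of_real (cot_res p x)"
  have unit: "cnj (\<psi> x) * \<psi> x = 1" if "coprime x (int p)" for x
    using norm_dirichlet_character[OF psi p1 that] by (metis complex_norm_square mult.commute of_real_1 one_power2)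
  have T: "T = \<psi> q * (\<Sum>n=1..<int p. \<psi> n * ?c (q * n))" if "coprime q (int p)" for q
  proof -
    have "T = (\<Sum>n=1..<int p. \<psi> (q * n) * ?c (q * n))"
      unfolding T_def
      by (rule sum_mult_residues[OF p that, symmetric])
         (metis cot_res_cong[OF p0] dirichlet_character_cong[OF psi])
    then show ?thesis by (simp add: dirichlet_character_mult[OF psi] sum_distrib_left mult.assoc)
  qed
  have "cnj (\<psi> b) * T = (\<Sum>m=1..<int p. \<psi> m * ?c (b * m))"
    using T[OF b] unit[OF b] by (simp add: mult.assoc[symmetric])
  moreover have "\<psi> a * cnj T = cnj (\<Sum>n=1..<int p. \<psi> n * ?c (a * n))"
  proof -
    have "\<psi> a * cnj T = (cnj (\<psi> a) * \<psi> a) * cnj (\<Sum>n=1..<int p. \<psi> n * ?c (a * n))"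
      by (subst T[OF a]) (simp add: mult_ac)
    then show ?thesis by (simp add: unit[OF a])
  qed
  moreover have "\<psi> a * cnj (\<psi> b) * of_real ((cmod T)\<^sup>2) = (cnj (\<psi> b) * T) * (\<psi> a * cnj T)"
    by (simp only: complex_norm_square mult_ac)
  ultimately have "\<psi> a * cnj (\<psi> b) * of_real ((cmod T)\<^sup>2) =
      (\<Sum>m=1..<int p. \<psi> m * ?c (b * m)) * (\<Sum>n=1..<int p. cnj (\<psi> n) * ?c (a * n))"
    by (simp only: cnj_sum complex_cnj_mult complex_cnj_complex_of_real)
  also have "\<dots> = (\<Sum>n=1..<int p. cnj (\<psi> n) * ?c (a * n) * (\<Sum>m=1..<int p. \<psi> m * ?c (b * m)))"
    by (subst mult.commute) (rule sum_distrib_right)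
  also have "\<dots> = (\<Sum>n=1..<int p. \<Sum>l=1..<int p. \<psi> l * (?c (a * n) * ?c (b * l * n)))"
  proof (intro sum.cong refl)
    fix n assume "n \<in> {1..<int p}"
    then have n: "coprime n (int p)" by (rule coprime_prime_residue[OF p])
    have "(\<Sum>m=1..<int p. \<psi> m * ?c (b * m)) = (\<Sum>l=1..<int p. \<psi> (n * l) * ?c (b * (n * l)))"
      by (rule sum_mult_residues[OF p n, symmetric])
         (metis cong_scalar_left cot_res_cong[OF p0] dirichlet_character_cong[OF psi])
    then have "cnj (\<psi> n) * ?c (a * n) * (\<Sum>m=1..<int p. \<psi> m * ?c (b * m)) =
        (\<Sum>l=1..<int p. (cnj (\<psi> n) * \<psi> n) * (\<psi> l * (?c (a * n) * ?c (b * l * n))))"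
      by (simp add: dirichlet_character_mult[OF psi] sum_distrib_left mult_ac)
    then show "cnj (\<psi> n) * ?c (a * n) * (\<Sum>m=1..<int p. \<psi> m * ?c (b * m)) =
        (\<Sum>l=1..<int p. \<psi> l * (?c (a * n) * ?c (b * l * n)))"
      by (simp add: unit[OF n])
  qed
  also have "\<dots> = (\<Sum>l=1..<int p. \<psi> l * of_real (cot_sum p a (b * l)))"
    by (subst sum.swap) (simp add: cot_sum_def sum_distrib_left)
  finally show ?thesis .
qed

text \<open>Each summand of the mean is a combination of the values \<open>\<psi> l\<close> with
  coefficients \<open>cot_sum p q1 (q2 * l)\<close> independent of \<open>\<psi>\<close>, so
  orthogonality keeps only \<open>l\<close> in \<open>H\<close> or \<open>- H\<close>.\<close>

lemma mean_square_eq_cot_sum: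
  assumes p: "prime p" "p \<ge> 3" and H: "subgroup H (unit_group_mod p)" and odd: "odd (card H)"
    and q1: "coprime q1 p" and q2: "coprime q2 p"
  shows "mean_square q1 q2 p H =
    of_real (pi\<^sup>2 / (2 * (real p)\<^sup>2) * (\<Sum>h\<in>H. cot_sum p (int q1) (int q2 * h)))"
proof -
  let ?X = "odd_chars p H"
  let ?D = "\<lambda>l. cot_sum p (int q1) (int q2 * l)"
  define \<kappa> where "\<kappa> = pi / (2 * real p)"
  have p1: "p > 1" using p by simp
  have cop: "coprime (int q1) (int p)" "coprime (int q2) (int p)" using q1 q2 by simp_all
  have fin: "finite ?X" by (rule finite_odd_chars[OF p(1)])
  obtain \<omega> where "\<omega> \<in> ?X" using odd_character_with_kernel[OF p H odd] by blast
  then have card: "card ?X > 0" using fin card_gt_0_iff by blast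
  note sub = subgroup_subset[OF p(1) H]
  have D_minus: "?D (- l) = - ?D l" for l
    by (simp add: cot_sum_def cot_res_minus sum_negf)
  have D_cong: "?D x = ?D y" if "[x = y] (mod int p)" for x y
    unfolding cot_sum_def using that p1
    by (intro sum.cong refl arg_cong2[where f = "(*)"] cot_res_cong cong_mult cong_refl) auto
  have L: "\<psi> (int q1) * cnj (\<psi> (int q2)) * of_real ((cmod (L_one \<psi>))\<^sup>2) =
      of_real (\<kappa>\<^sup>2) * (\<Sum>l=1..<int p. \<psi> l * of_real (?D l))" if "\<psi> \<in> ?X" for \<psi>
  proof -
    have psi: "dirichlet_character p \<psi>" "\<psi> (- 1) = - 1" using that by (auto simp: odd_chars_def)
    define T where "T = (\<Sum>n=1..<int p. \<psi> n * of_real (cot_res p n))"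
    have "L_one \<psi> = of_real \<kappa> * T"
      using L_one_odd_character[OF psi p1] by (simp add: \<kappa>_def T_def cot_res_def)
    then have "\<psi> (int q1) * cnj (\<psi> (int q2)) * of_real ((cmod (L_one \<psi>))\<^sup>2) =
        of_real (\<kappa>\<^sup>2) * (\<psi> (int q1) * cnj (\<psi> (int q2)) * of_real ((cmod T)\<^sup>2))"
      by (simp add: norm_mult power_mult_distrib)
    then show ?thesis unfolding T_def twisted_square_expand[OF p(1) psi(1) cop] .
  qed
  have "(\<Sum>\<psi>\<in>?X. \<psi> (int q1) * cnj (\<psi> (int q2)) * of_real ((cmod (L_one \<psi>))\<^sup>2)) =
      (\<Sum>\<psi>\<in>?X. of_real (\<kappa>\<^sup>2) * (\<Sum>l=1..<int p. \<psi> l * of_real (?D l)))"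
    by (intro sum.cong refl L)
  also have "\<dots> = of_real (\<kappa>\<^sup>2) * (\<Sum>l=1..<int p. (\<Sum>\<psi>\<in>?X. \<psi> l) * of_real (?D l))"
    by (simp only: sum_distrib_left[symmetric] sum_distrib_right, subst sum.swap, rule refl)
  also have "(\<Sum>l=1..<int p. (\<Sum>\<psi>\<in>?X. \<psi> l) * of_real (?D l)) =
      (\<Sum>l=1..<int p. of_nat (card ?X) * of_real ((of_bool (l \<in> H) - of_bool (int p - l \<in> H)) * ?D l))"
  proof (intro sum.cong refl)
    fix l assume l: "l \<in> {1..<int p}"
    then have "l mod int p = l" by simp
    moreover have "- l mod int p = int p - l" using l by (simp add: zmod_zminus1_eq_if)
    ultimately show "(\<Sum>\<psi>\<in>?X. \<psi> l) * of_real (?D l) =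
        of_nat (card ?X) * of_real ((of_bool (l \<in> H) - of_bool (int p - l \<in> H)) * ?D l)"
      using sum_odd_chars[OF p H odd coprime_prime_residue[OF p(1) l]] by simp
  qed
  also have "\<dots> = of_nat (card ?X) *
      of_real (\<Sum>l=1..<int p. (of_bool (l \<in> H) - of_bool (int p - l \<in> H)) * ?D l)"
    by (simp only: sum_distrib_left of_real_sum)
  \<comment> \<open>Both surviving classes contribute equally because \<open>?D\<close> is odd. This
    doubles \<open>\<kappa>^2 = pi^2 / (4 p^2)\<close> to the stated factor.\<close>
  also have "(\<Sum>l=1..<int p. (of_bool (l \<in> H) - of_bool (int p - l \<in> H)) * ?D l) = 2 * (\<Sum>h\<in>H. ?D h)"
  proof -
    have 1: "(\<Sum>l=1..<int p. of_bool (l \<in> H) * ?D l) = (\<Sum>h\<in>H. ?D h)"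
      using sub by (intro sum.mono_neutral_cong_right) auto
    have "(\<Sum>l=1..<int p. of_bool (int p - l \<in> H) * ?D l) = (\<Sum>l=1..<int p. of_bool (l \<in> H) * ?D (int p - l))"
      by (rule sum.reindex_bij_witness[of _ "\<lambda>a. int p - a" "\<lambda>a. int p - a"]) auto
    also have "\<dots> = (\<Sum>l=1..<int p. - (of_bool (l \<in> H) * ?D l))"
    proof (intro sum.cong refl)
      fix l
      have "?D (int p - l) = ?D (- l)"
        by (rule D_cong) (simp add: cong_iff_dvd_diff)
      then have "?D (int p - l) = - ?D l" by (rule trans[OF _ D_minus])
      then show "of_bool (l \<in> H) * ?D (int p - l) = - (of_bool (l \<in> H) * ?D l)"
        by simp
    qed
    also have "\<dots> = - (\<Sum>h\<in>H. ?D h)" by (simp only: sum_negf 1)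
    finally show ?thesis by (simp only: left_diff_distrib sum_subtractf 1)
  qed
  finally show ?thesis
    using card by (simp add: mean_square_def \<kappa>_def power_divide field_simps)
qed

section \<open>Estimates for cotangent sums\<close>

lemma mult_cos_le_sin:
  fixes x :: real
  assumes "0 \<le> x" "x < pi / 2"
  shows "x * cos x \<le> sin x"
proof -
  have "(\<lambda>x. sin x - x * cos x) 0 \<le> (\<lambda>x. sin x - x * cos x) x"
  proof (rule DERIV_nonneg_imp_nondecreasing[OF assms(1)])
    fix y assume y: "0 \<le> y" "y \<le> x"
    then have "y * sin y \<ge> 0" using assms(2) by (intro mult_nonneg_nonneg sin_ge_zero) auto
    moreover have "((\<lambda>x. sin x - x * cos x) has_real_derivative y * sin y) (at y)"
      by (auto intro!: derivative_eq_intros)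
    ultimately show "\<exists>l. ((\<lambda>x. sin x - x * cos x) has_real_derivative l) (at y) \<and> 0 \<le> l" by blast
  qed
  then show ?thesis by simp
qed

lemma cot_bounds:
  fixes x :: real
  assumes "0 < x" "x \<le> pi / 2"
  shows "0 \<le> cot x" and "x * cot x \<le> 1" and "cos x \<le> x * cot x"
proof -
  have s: "sin x > 0" using assms by (intro sin_gt_zero) auto
  have c: "cos x \<ge> 0" using assms by (intro cos_ge_zero) auto
  show "0 \<le> cot x" using s c by (simp add: cot_def)
  have "x * cos x \<le> sin x"
  proof (cases "x = pi / 2")
    case True
    then have "cos x = 0" by (simp only: cos_pi_half)
    then show ?thesis using s by simp
  qed (use mult_cos_le_sin[of x] assms in auto)
  then show "x * cot x \<le> 1" using s by (simp add: cot_def)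
  have "sin x \<le> x" using assms by (intro sin_x_le_x) auto
  then have "cos x * sin x \<le> cos x * x" using c by (intro mult_left_mono)
  then show "cos x \<le> x * cot x" using s by (simp add: cot_def field_simps)
qed

lemma cos_ge_one_minus: "1 - x\<^sup>2 / 2 \<le> cos (x::real)"
proof -
  have "\<bar>sin (x / 2)\<bar> \<le> \<bar>x / 2\<bar>" by (rule abs_sin_x_le_abs_x)
  then have "(sin (x / 2))\<^sup>2 \<le> (x / 2)\<^sup>2" by (simp only: abs_le_square_iff)
  moreover have "cos x = 1 - 2 * (sin (x / 2))\<^sup>2" using cos_double_sin[of "x / 2"] by simp
  ultimately show ?thesis by (simp add: power_divide)
qed

text \<open>With \<open>s = x cot x\<close> and \<open>t = y cot y\<close> in \<open>[0, 1]\<close>,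
  the relative error satisfies
  \<open>1 - s t \<le> (1 - s) + (1 - t) \<le> (x^2 + y^2) / 2\<close>.\<close>

lemma cot_product_approx:
  fixes x y :: real
  assumes x: "0 < x" "x \<le> pi / 2" and y: "0 < y" "y \<le> pi / 2"
  shows "\<bar>cot x * cot y - 1 / (x * y)\<bar> \<le> (x / y + y / x) / 2"
proof -
  define s where "s = x * cot x"
  define t where "t = y * cot y"
  note b = cot_bounds[OF x, folded s_def] cot_bounds[OF y, folded t_def]
  have s0: "0 \<le> s" and t0: "0 \<le> t" using x y b by (auto simp: s_def t_def)
  have st: "s * t \<le> 1" using s0 t0 b mult_mono[of s 1 t 1] by simp
  have "1 - s \<le> x\<^sup>2 / 2" "1 - t \<le> y\<^sup>2 / 2"
    using b cos_ge_one_minus[of x] cos_ge_one_minus[of y] by linarith+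
  moreover have "(1 - s) * (1 - t) \<ge> 0" using b by simp
  ultimately have "1 - s * t \<le> (x\<^sup>2 + y\<^sup>2) / 2" by (simp add: algebra_simps)
  then have "(1 - s * t) / (x * y) \<le> ((x\<^sup>2 + y\<^sup>2) / 2) / (x * y)"
    using x y by (intro divide_right_mono) auto
  moreover have "((x\<^sup>2 + y\<^sup>2) / 2) / (x * y) = (x / y + y / x) / 2"
    using x y by (simp add: field_simps power2_eq_square)
  moreover have "1 / (x * y) - cot x * cot y = (1 - s * t) / (x * y)"
    using x y by (simp add: s_def t_def field_simps)
  moreover have "(1 - s * t) / (x * y) \<ge> 0" using st x y by simp
  ultimately show ?thesis by linarith
qed

lemma one_le_ln: "3 \<le> p \<Longrightarrow> 1 \<le> ln (real p)"
  using exp_le by (subst ln_ge_iff) (auto simp: numeral_le_real_of_nat_iff intro: order.trans)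

lemma harm_le: "n > 0 \<Longrightarrow> harm n \<le> 1 + ln (real n)"
  using decseqD[OF decseq_harm_diff_ln, of 0 "n - 1"] by (simp add: harm_expand)

text \<open>The partial sums increase to \<open>pi^2 / 6\<close>, while adding
  \<open>2 / (N + 1)\<close> makes them decrease to the same limit.\<close>

lemma inverse_squares_tail:
  "\<bar>pi\<^sup>2 / 6 - (\<Sum>k<N. 1 / (real k + 1)\<^sup>2)\<bar> \<le> 2 / (real N + 1)"
proof -
  define g where "g N = (\<Sum>k<N. 1 / (real k + 1)\<^sup>2) + 2 / (real N + 1)" for N
  have sums: "(\<lambda>k. 1 / (real k + 1)\<^sup>2) sums (pi\<^sup>2 / 6)"
    using inverse_squares_sums by (simp add: add.commute)
  have "g (Suc n) \<le> g n" for n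
  proof -
    have "1 / (real n + 1)\<^sup>2 + 2 / (real n + 2) \<le> 2 / (real n + 1)"
      by (simp add: divide_simps power2_eq_square) (simp add: algebra_simps)
    then show ?thesis by (simp add: g_def add_ac)
  qed
  then have "decseq g" by (rule decseq_SucI)
  moreover have "g \<longlonglongrightarrow> pi\<^sup>2 / 6 + 0"
    unfolding g_def
  proof (rule tendsto_add)
    show "(\<lambda>N. \<Sum>k<N. 1 / (real k + 1)\<^sup>2) \<longlonglongrightarrow> pi\<^sup>2 / 6" using sums by (simp add: sums_def)
    show "(\<lambda>N. 2 / (real N + 1)) \<longlonglongrightarrow> 0"
      using tendsto_mult[OF tendsto_const[of 2] LIMSEQ_inverse_real_of_nat] by (simp add: divide_inverse add.commute)
  qed
  ultimately have "pi\<^sup>2 / 6 \<le> g N" using decseq_ge by fastforce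
  moreover have "(\<Sum>k<N. 1 / (real k + 1)\<^sup>2) \<le> pi\<^sup>2 / 6"
    using sums sum_le_suminf[of "\<lambda>k. 1 / (real k + 1)\<^sup>2" "{..<N}"] by (simp add: sums_iff)
  ultimately show ?thesis by (simp add: g_def)
qed

section \<open>Absolutely least residues and bounds for the cotangent in terms of them\<close>

definition centered_mod :: "nat \<Rightarrow> int \<Rightarrow> int" where
  "centered_mod p x = (x + int p div 2) mod int p - int p div 2"

lemma centered_mod_cong: "[centered_mod p x = x] (mod int p)"
  by (simp add: centered_mod_def unique_euclidean_semiring_class.cong_def mod_diff_left_eq)

lemma centered_mod_eq: "[x = y] (mod int p) \<Longrightarrow> centered_mod p x = centered_mod p y"
  unfolding centered_mod_def unique_euclidean_semiring_class.cong_def by (metis mod_add_left_eq)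

lemma centered_mod_bound:
  assumes "p > 0"
  shows "2 * \<bar>centered_mod p x\<bar> \<le> int p"
proof -
  define h where "h = int p div 2"
  define m where "m = (x + h) mod int p"
  have "0 \<le> m" "m < int p" using assms by (simp_all add: m_def)
  moreover have "2 * h \<le> int p" "int p \<le> 2 * h + 1" unfolding h_def by presburger+
  ultimately show ?thesis unfolding centered_mod_def h_def[symmetric] m_def[symmetric] by (cases "m \<ge> h") auto
qed

lemma centered_mod_residue:
  assumes "n \<in> {1..<int p}"
  shows "centered_mod p n = n \<or> centered_mod p n = n - int p"
proof -
  have "int p dvd centered_mod p n - n" using centered_mod_cong by (simp add: cong_iff_dvd_diff)
  then obtain k where k: "centered_mod p n = n + int p * k" by (auto simp: dvd_def algebra_simps)
  define m where "m = int p * k"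
  have p: "int p > 0" using assms by auto
  have b: "2 * \<bar>n + m\<bar> \<le> int p" using centered_mod_bound[of p n] p k by (simp add: m_def)
  have "k = 0 \<or> k = -1"
  proof (rule ccontr)
    assume "\<not> (k = 0 \<or> k = -1)"
    then have "k \<ge> 1 \<or> k \<le> -2" by linarith
    then show False
    proof
      assume "k \<ge> 1"
      then have "int p * 1 \<le> m" unfolding m_def using p by (intro mult_left_mono) auto
      moreover have "1 \<le> n" using assms by simp
      ultimately show False using b p by auto
    next
      assume "k \<le> - 2"
      then have "m \<le> int p * (- 2)" unfolding m_def using p by (intro mult_left_mono) auto
      moreover have "n < int p" using assms by simp
      ultimately show False using b p by auto
    qed
  qed
  then show ?thesis using k by auto
qed

lemma centered_mod_nonzero: "coprime x (int p) \<Longrightarrow> p > 1 \<Longrightarrow> centered_mod p x \<noteq> 0"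
  using cong_dvd_iff[OF centered_mod_cong, of p x] by (auto simp: coprime_absorb_right)

text \<open>Periodicity and oddness move the argument into the interval from 0 to
  \<open>pi / 2\<close>, where \<open>cot y \<le> 1 / y\<close>.\<close>

lemma abs_cot_res_le:
  assumes p: "p > 0" and nz: "centered_mod p x \<noteq> 0"
  shows "\<bar>cot_res p x\<bar> \<le> real p / (pi * of_int \<bar>centered_mod p x\<bar>)"
proof -
  let ?c = "centered_mod p x"
  have "cot_res p x = cot_res p ?c"
    using cot_res_cong[OF p] centered_mod_cong by metis
  also have "\<bar>cot_res p ?c\<bar> = \<bar>cot_res p \<bar>?c\<bar>\<bar>"
    by (cases "?c \<ge> 0") (simp_all add: cot_res_minus)
  finally have eq: "\<bar>cot_res p x\<bar> = \<bar>cot_res p \<bar>?c\<bar>\<bar>" .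
  define y where "y = pi * of_int \<bar>?c\<bar> / real p"
  have "2 * real_of_int \<bar>?c\<bar> \<le> real p" using centered_mod_bound[OF p, of x] by linarith
  then have "pi * (2 * real_of_int \<bar>?c\<bar>) \<le> pi * real p" by (intro mult_left_mono) auto
  then have y: "0 < y" "y \<le> pi / 2" using p nz by (auto simp: y_def field_simps)
  have "cot y \<le> 1 / y" using cot_bounds(2)[OF y] y by (simp add: field_simps)
  moreover have "1 / y = real p / (pi * of_int \<bar>?c\<bar>)" by (simp add: y_def)
  ultimately show ?thesis using eq cot_bounds(1)[OF y] by (simp add: cot_res_def y_def)
qed

text \<open>
  Cut the plane into squares of side \<open>L\<close>: each square contains at most one point of each sign
  pattern, and the square at the origin contains none.
\<close>

lemma sum_inverse_products_separated:
  fixes a b :: "'i \<Rightarrow> int" and L M :: real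
  assumes fin: "finite I" and L: "L > 0"
    and nz: "\<And>i. i \<in> I \<Longrightarrow> a i \<noteq> 0 \<and> b i \<noteq> 0"
    and bd: "\<And>i. i \<in> I \<Longrightarrow> \<bar>a i\<bar> \<le> M \<and> \<bar>b i\<bar> \<le> M"
    and origin: "\<And>i. i \<in> I \<Longrightarrow> L \<le> \<bar>a i\<bar> \<or> L \<le> \<bar>b i\<bar>"
    and sep: "\<And>i j. i \<in> I \<Longrightarrow> j \<in> I \<Longrightarrow> i \<noteq> j \<Longrightarrow> L \<le> \<bar>a i - a j\<bar> \<or> L \<le> \<bar>b i - b j\<bar>"
  shows "(\<Sum>i\<in>I. 1 / (of_int \<bar>a i\<bar> * of_int \<bar>b i\<bar>)) \<le> 4 * ((1 + harm (nat \<lfloor>M / L\<rfloor>) / L)\<^sup>2 - 1)"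
proof -
  define J where "J = nat \<lfloor>M / L\<rfloor>"
  \<comment> \<open>\<open>u k\<close> bounds \<open>1 / \<bar>x\<bar>\<close> on the strip
    \<open>c x = k\<close>: by 1 if \<open>k = 0\<close>, where only integrality of the nonzero
    \<open>x\<close> helps, and by \<open>1 / (L k)\<close> otherwise.\<close>
  define u :: "nat \<Rightarrow> real" where "u k = (if k = 0 then 1 else 1 / (L * real k))" for k
  define c where "c x = nat \<lfloor>real_of_int \<bar>x\<bar> / L\<rfloor>" for x :: int
  define cell where "cell i = ((a i > 0, b i > 0), (c (a i), c (b i)))" for i
  define w :: "(bool \<times> bool) \<times> (nat \<times> nat) \<Rightarrow> real" where "w = (\<lambda>(_, (k, l)). u k * u l)"
  let ?B = "{..J} \<times> {..J} - {(0, 0)}"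
  have u0: "u k \<ge> 0" for k using L by (simp add: u_def)
  have c_le: "L * real (c x) \<le> \<bar>x\<bar>" for x
  proof -
    have "real (c x) \<le> real_of_int \<bar>x\<bar> / L" using L by (simp add: c_def)
    then show ?thesis using L by (simp add: field_simps)
  qed
  have c_gt: "\<bar>x\<bar> < L * (real (c x) + 1)" for x
  proof -
    have "real_of_int \<bar>x\<bar> / L < real (c x) + 1" using L by (simp add: c_def)
    then show ?thesis using L by (simp add: field_simps)
  qed
  have c_u: "1 / of_int \<bar>x\<bar> \<le> u (c x)" if "x \<noteq> 0" for x
  proof (cases "c x = 0")
    case True
    then show ?thesis using that by (simp add: u_def)
  next
    case False
    then show ?thesis using c_le[of x] that L by (simp add: u_def frac_le)
  qed
  have c_J: "c x \<le> J" if "\<bar>x\<bar> \<le> M" for x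
    unfolding c_def J_def using that L by (intro nat_mono floor_mono divide_right_mono) auto
  have close: "\<bar>x - y\<bar> < L" if "c x = c y" "x > 0 \<longleftrightarrow> y > 0" "x \<noteq> 0" "y \<noteq> 0" for x y :: int
  proof -
    have "real_of_int \<bar>x\<bar> < real_of_int \<bar>y\<bar> + L" "real_of_int \<bar>y\<bar> < real_of_int \<bar>x\<bar> + L"
      using c_le[of x] c_gt[of x] c_le[of y] c_gt[of y] that(1) by (auto simp: algebra_simps)
    then show ?thesis using that(2-4) by (cases "x > 0") (simp_all add: abs_if split: if_splits)
  qed
  have inj: "inj_on cell I"
  proof (rule inj_onI)
    fix i j assume ij: "i \<in> I" "j \<in> I" "cell i = cell j"
    then have "\<bar>a i - a j\<bar> < L" "\<bar>b i - b j\<bar> < L"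
      using nz[of i] nz[of j] close[of "a i" "a j"] close[of "b i" "b j"] by (auto simp: cell_def)
    then show "i = j" using sep[of i j] ij by force
  qed
  have img: "cell ` I \<subseteq> UNIV \<times> ?B"
  proof
    fix z assume "z \<in> cell ` I"
    then obtain i where i: "i \<in> I" "z = cell i" by auto
    have "c (a i) \<noteq> 0 \<or> c (b i) \<noteq> 0"
    proof (rule ccontr)
      assume "\<not> (c (a i) \<noteq> 0 \<or> c (b i) \<noteq> 0)"
      then show False using origin[OF i(1)] c_gt[of "a i"] c_gt[of "b i"] by auto
    qed
    then show "z \<in> UNIV \<times> ?B" using bd[OF i(1)] i c_J by (auto simp: cell_def)
  qed
  have "(\<Sum>k\<le>J. u k) = 1 + harm J / L"
  proof -
    have "(\<Sum>k\<le>J. u k) = 1 + (\<Sum>k=1..J. u k)"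
      by (simp add: sum.atMost_shift u_def sum.atLeast1_atMost_eq)
    also have "(\<Sum>k=1..J. u k) = harm J / L"
      unfolding harm_def sum_divide_distrib by (intro sum.cong refl) (auto simp: u_def field_simps)
    finally show ?thesis .
  qed
  note sum_u = this
  have "(\<Sum>i\<in>I. 1 / (of_int \<bar>a i\<bar> * of_int \<bar>b i\<bar>)) \<le> (\<Sum>i\<in>I. w (cell i))"
  proof (rule sum_mono)
    fix i assume "i \<in> I"
    then have "1 / of_int \<bar>a i\<bar> * (1 / of_int \<bar>b i\<bar>) \<le> u (c (a i)) * u (c (b i))"
      using nz u0 by (intro mult_mono c_u) auto
    then show "1 / (of_int \<bar>a i\<bar> * of_int \<bar>b i\<bar>) \<le> w (cell i)"
      by (simp add: w_def cell_def)
  qed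
  also have "\<dots> = sum w (cell ` I)" by (simp add: sum.reindex[OF inj])
  also have "\<dots> \<le> sum w (UNIV \<times> ?B)"
    using img u0 by (intro sum_mono2) (auto simp: w_def)
  also have "\<dots> = (\<Sum>s\<in>(UNIV :: (bool \<times> bool) set). \<Sum>z\<in>?B. w (s, z))"
    by (simp add: sum.cartesian_product)
  \<comment> \<open>There are four sign patterns. The excluded cell \<open>(0, 0)\<close> has weight
    1, which is the subtracted term.\<close>
  also have "\<dots> = 4 * (\<Sum>(k, l)\<in>?B. u k * u l)" by (simp add: w_def card_UNIV_bool)
  also have "(\<Sum>(k, l)\<in>?B. u k * u l) = (\<Sum>(k, l)\<in>{..J} \<times> {..J}. u k * u l) - 1"
    by (subst sum_diff1) (auto simp: u_def)
  also have "(\<Sum>(k, l)\<in>{..J} \<times> {..J}. u k * u l) = (\<Sum>k\<le>J. u k)\<^sup>2"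
    by (simp add: power2_eq_square sum_product sum.cartesian_product)
  finally show ?thesis unfolding J_def[symmetric] by (simp only: sum_u)
qed

lemma abs_cot_res_mult_le:
  assumes p: "prime p" and x: "coprime x (int p)" and y: "coprime y (int p)"
  shows "\<bar>cot_res p x * cot_res p y\<bar> \<le>
    (real p)\<^sup>2 * (1 / (of_int \<bar>centered_mod p x\<bar> * of_int \<bar>centered_mod p y\<bar>))"
proof -
  let ?a = "real_of_int \<bar>centered_mod p x\<bar>" and ?b = "real_of_int \<bar>centered_mod p y\<bar>"
  have p1: "p > 1" using p by (rule prime_gt_1_nat)
  note nz = centered_mod_nonzero[OF x p1] centered_mod_nonzero[OF y p1]
  then have pos: "?a > 0" "?b > 0" by auto
  have "real p / (pi * z) \<le> real p / z" if "z > 0" for z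
  proof (rule divide_left_mono)
    have "1 * z \<le> pi * z" using that pi_gt3 by (intro mult_right_mono) auto
    then show "z \<le> pi * z" by simp
  qed (use that in auto)
  then have "\<bar>cot_res p x\<bar> \<le> real p / ?a" "\<bar>cot_res p y\<bar> \<le> real p / ?b"
    using order.trans[OF abs_cot_res_le] nz p1 pos by simp_all
  then have "\<bar>cot_res p x\<bar> * \<bar>cot_res p y\<bar> \<le> (real p / ?a) * (real p / ?b)"
    using pos by (intro mult_mono) auto
  then show ?thesis by (simp add: abs_mult power2_eq_square)
qed

text \<open>The terms with \<open>n\<close> or \<open>p - n\<close> at most \<open>p div (a + b)\<^sup>2\<close> carry the main term.\<close>

lemma cot_sum_principal:
  fixes a b p :: nat
  assumes p: "prime p" "p \<ge> 3" and ab: "a \<ge> 1" "b \<ge> 1" "coprime a b"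
    and ap: "coprime a p" and bp: "coprime b p"
  defines "Q \<equiv> real (a + b)"
  shows "\<bar>cot_sum p (int a) (int b) - (real p)\<^sup>2 / (3 * real a * real b)\<bar>
    \<le> (2 + 4 * Q\<^sup>2 + 16 * Q) * (real p * ln (real p))"
proof -
  \<comment> \<open>For \<open>n \<le> N\<close> both \<open>a n\<close> and \<open>b n\<close> stay
    at most \<open>p / 2\<close>, so no reduction modulo \<open>p\<close> occurs. For
    \<open>N < n < p - N\<close> one of the two least residues has absolute value at least
    \<open>p / (2 Q)\<close>.\<close>
  define N where "N = p div (a + b)\<^sup>2"
  define f where "f n = cot_res p (int a * n) * cot_res p (int b * n)" for n
  define A where "A n = centered_mod p (int a * n)" for n
  define B where "B n = centered_mod p (int b * n)" for n
  have p1: "p > 1" using p by simp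
  have ln1: "1 \<le> ln (real p)"
    using one_le_ln[OF p(2)] .
  have Q2: "Q \<ge> 2" using ab by (simp add: Q_def)
  have cop: "coprime (int q * n) (int p)" if "n \<in> {1..<int p}" "coprime q p" for q n
    using that coprime_prime_residue[OF p(1)] by simp
  have NQ: "real N * Q\<^sup>2 \<le> real p" "real p < (real N + 1) * Q\<^sup>2"
  proof -
    have "N * (a + b)\<^sup>2 \<le> p" by (simp add: N_def)
    then have "real (N * (a + b)\<^sup>2) \<le> real p" by (simp only: of_nat_le_iff)
    then show "real N * Q\<^sup>2 \<le> real p" by (simp only: of_nat_mult of_nat_power Q_def)
    have "p < (a + b)\<^sup>2 + N * (a + b)\<^sup>2"
      unfolding N_def using ab by (intro dividend_less_div_times) simp
    then have "real p < real ((N + 1) * (a + b)\<^sup>2)" by (simp only: of_nat_less_iff) simp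
    then show "real p < (real N + 1) * Q\<^sup>2"
      by (simp only: of_nat_mult of_nat_power of_nat_add of_nat_1 Q_def)
  qed
  have N4: "4 * N \<le> p"
  proof -
    have "real N * 2\<^sup>2 \<le> real N * Q\<^sup>2" using Q2 by (intro mult_left_mono power_mono) auto
    then have "real (4 * N) \<le> real p" using NQ(1) by simp
    then show ?thesis by (simp only: of_nat_le_iff)
  qed
  have f_refl: "f (int p - n) = f n" for n
  proof -
    have "cot_res p (int q * (int p - n)) = - cot_res p (int q * n)" for q
    proof -
      have "[int q * (int p - n) = - (int q * n)] (mod int p)"
        by (simp add: cong_iff_dvd_diff algebra_simps)
      then show ?thesis using cot_res_cong p1 by (simp add: cot_res_minus)
    qed
    then show ?thesis by (simp add: f_def)
  qed
  have split: "cot_sum p (int a) (int b) = 2 * (\<Sum>n=1..int N. f n) + (\<Sum>n\<in>{int N<..<int p - int N}. f n)"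
  proof -
    have "{1..<int p} = {1..int N} \<union> ({int N<..<int p - int N} \<union> {int p - int N..<int p})"
      using N4 p1 by auto
    then have "cot_sum p (int a) (int b) =
        (\<Sum>n\<in>{1..int N} \<union> ({int N<..<int p - int N} \<union> {int p - int N..<int p}). f n)"
      by (simp add: cot_sum_def f_def)
    also have "\<dots> = (\<Sum>n=1..int N. f n) + ((\<Sum>n\<in>{int N<..<int p - int N}. f n) + (\<Sum>n\<in>{int p - int N..<int p}. f n))"
      using N4 p1 by (subst sum.union_disjoint, simp, simp, force, subst sum.union_disjoint) auto
    also have "(\<Sum>n\<in>{int p - int N..<int p}. f n) = (\<Sum>n=1..int N. f n)"
      by (rule sum.reindex_bij_witness[of _ "\<lambda>n. int p - n" "\<lambda>n. int p - n"]) (auto simp: f_refl)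
    finally show ?thesis by simp
  qed
  define S where "S = (\<Sum>k<N. 1 / (real k + 1)\<^sup>2)"
  define \<gamma> where "\<gamma> = (real p)\<^sup>2 / (pi\<^sup>2 * real a * real b)"
  \<comment> \<open>Each of the \<open>N\<close> terms deviates from \<open>\<gamma> / n^2\<close>
    by at most \<open>Q^2\<close>, and \<open>N * Q^2 \<le> p\<close>.\<close>
  have near: "\<bar>(\<Sum>n=1..int N. f n) - \<gamma> * S\<bar> \<le> real p"
  proof -
    have S: "S = (\<Sum>n=1..int N. 1 / (of_int n)\<^sup>2)"
      unfolding S_def
      by (rule sum.reindex_bij_witness[of _ "\<lambda>n. nat n - 1" "\<lambda>k. int k + 1"]) (auto simp: of_nat_diff add.commute)
    have "\<bar>(\<Sum>n=1..int N. f n) - \<gamma> * S\<bar> = \<bar>\<Sum>n=1..int N. f n - \<gamma> * (1 / (of_int n)\<^sup>2)\<bar>"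
      by (simp only: S sum_distrib_left sum_subtractf)
    also have "\<dots> \<le> (\<Sum>n=1..int N. Q\<^sup>2)"
    proof (rule order.trans[OF sum_abs sum_mono])
      fix n :: int assume n: "n \<in> {1..int N}"
      have range: "0 < pi * real_of_int (int q * n) / real p" "pi * real_of_int (int q * n) / real p \<le> pi / 2"
        if "q = a \<or> q = b" for q
      proof -
        have q: "1 \<le> q" "real q \<le> Q" using that ab by (auto simp: Q_def)
        show "0 < pi * real_of_int (int q * n) / real p" using q n p1 by simp
        have "2 * (real q * real_of_int n) \<le> Q * (Q * real N)"
          using q n Q2 by (intro mult_mono) auto
        also have "\<dots> \<le> real p" using NQ(1) by (simp add: power2_eq_square mult_ac)
        finally have "pi * (2 * (real q * real_of_int n)) \<le> pi * real p" by (intro mult_left_mono) auto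
        then show "pi * real_of_int (int q * n) / real p \<le> pi / 2" using p1 by (simp add: field_simps)
      qed
      let ?x = "pi * real_of_int (int a * n) / real p" and ?y = "pi * real_of_int (int b * n) / real p"
      have approx: "\<bar>cot ?x * cot ?y - 1 / (?x * ?y)\<bar> \<le> (?x / ?y + ?y / ?x) / 2"
        by (rule cot_product_approx) (use range in blast)+
      have main: "1 / (?x * ?y) = \<gamma> * (1 / (of_int n)\<^sup>2)"
        using p1 by (simp add: \<gamma>_def power2_eq_square field_simps)
      have ratios: "?x / ?y = real a / real b" "?y / ?x = real b / real a" using n p1 ab by simp_all
      have "real a / real b \<le> Q\<^sup>2" "real b / real a \<le> Q\<^sup>2"
      proof -
        have "real a / real b \<le> real a / 1" "real b / real a \<le> real b / 1" using ab by (intro divide_left_mono; simp)+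
        moreover have "Q * 1 \<le> Q * Q" using Q2 by (intro mult_left_mono) auto
        ultimately show "real a / real b \<le> Q\<^sup>2" "real b / real a \<le> Q\<^sup>2"
          by (auto simp: power2_eq_square Q_def)
      qed
      moreover have "(r + s) / 2 \<le> z" if "r \<le> z" "s \<le> z" for r s z :: real using that by simp
      ultimately have "(real a / real b + real b / real a) / 2 \<le> Q\<^sup>2" by blast
      with approx have "\<bar>cot ?x * cot ?y - \<gamma> * (1 / (of_int n)\<^sup>2)\<bar> \<le> Q\<^sup>2"
        unfolding main ratios by (rule order.trans)
      then show "\<bar>f n - \<gamma> * (1 / (of_int n)\<^sup>2)\<bar> \<le> Q\<^sup>2"
        by (simp only: f_def cot_res_def)
    qed
    also have "\<dots> \<le> real p" using NQ(1) by simp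
    finally show ?thesis .
  qed
  have pi2: "pi\<^sup>2 \<ge> 1" using pi_gt3 by (intro one_le_power) simp
  have \<gamma>: "0 \<le> \<gamma>" "\<gamma> \<le> (real p)\<^sup>2"
  proof -
    have "1 * 1 * 1 \<le> pi\<^sup>2 * real a * real b" using pi2 ab by (intro mult_mono) auto
    then have "(real p)\<^sup>2 / (pi\<^sup>2 * real a * real b) \<le> (real p)\<^sup>2 / 1" by (intro divide_left_mono) auto
    then show "\<gamma> \<le> (real p)\<^sup>2" by (simp add: \<gamma>_def)
  qed (simp add: \<gamma>_def)
  \<comment> \<open>Completing the sum of inverse squares costs at most \<open>2 / (N + 1)\<close>,
    which is at most \<open>2 Q^2 / p\<close> by the choice of \<open>N\<close>.\<close>
  have tail: "\<bar>\<gamma> * S - \<gamma> * (pi\<^sup>2 / 6)\<bar> \<le> 2 * Q\<^sup>2 * real p"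
  proof -
    have "\<bar>\<gamma> * S - \<gamma> * (pi\<^sup>2 / 6)\<bar> = \<gamma> * \<bar>pi\<^sup>2 / 6 - S\<bar>"
      using \<gamma>(1) by (simp only: right_diff_distrib[symmetric] abs_mult abs_of_nonneg abs_minus_commute)
    also have "\<dots> \<le> (real p)\<^sup>2 * (2 / (real N + 1))"
      using \<gamma> inverse_squares_tail[of N] unfolding S_def by (intro mult_mono) auto
    also have "2 / (real N + 1) \<le> 2 * Q\<^sup>2 / real p"
      using NQ(2) p1 by (simp add: field_simps)
    then have "(real p)\<^sup>2 * (2 / (real N + 1)) \<le> (real p)\<^sup>2 * (2 * Q\<^sup>2 / real p)"
      by (intro mult_left_mono) auto
    also have "\<dots> = 2 * Q\<^sup>2 * real p" using p1 by (simp add: power2_eq_square)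
    finally show ?thesis .
  qed
  have far: "\<bar>\<Sum>n\<in>{int N<..<int p - int N}. f n\<bar> \<le> 16 * Q * (real p * ln (real p))"
  proof -
    \<comment> \<open>After the permutation \<open>n \<rightarrow> q n\<close> the least residue has
      absolute value \<open>n\<close> or \<open>p - n\<close>. Two harmonic sums give
      \<open>2 (1 + ln p) \<le> 4 ln p\<close>.\<close>
    have inv_sum: "(\<Sum>n=1..<int p. 1 / of_int \<bar>centered_mod p (int q * n)\<bar>) \<le> 4 * ln (real p)"
      if q: "coprime q p" for q
    proof -
      have "(\<Sum>n=1..<int p. 1 / of_int \<bar>centered_mod p (int q * n)\<bar>) =
          (\<Sum>n=1..<int p. 1 / real_of_int \<bar>centered_mod p n\<bar>)"
        by (rule sum_mult_residues[OF p(1)]) (use q in \<open>auto dest: centered_mod_eq\<close>)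
      also have "\<dots> \<le> (\<Sum>n=1..<int p. 1 / real_of_int n + 1 / real_of_int (int p - n))"
      proof (rule sum_mono)
        fix n assume "n \<in> {1..<int p}"
        then show "1 / real_of_int \<bar>centered_mod p n\<bar> \<le> 1 / real_of_int n + 1 / real_of_int (int p - n)"
          using centered_mod_residue[of n p] by auto
      qed
      also have "\<dots> = 2 * (\<Sum>n=1..<int p. 1 / real_of_int n)"
      proof -
        have "(\<Sum>n=1..<int p. 1 / real_of_int (int p - n)) = (\<Sum>n=1..<int p. 1 / real_of_int n)"
          by (rule sum.reindex_bij_witness[of _ "\<lambda>n. int p - n" "\<lambda>n. int p - n"]) auto
        then show ?thesis by (simp only: sum.distrib mult_2)
      qed
      also have "(\<Sum>n=1..<int p. 1 / real_of_int n) = harm (p - 1)"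
        unfolding harm_def
        by (rule sum.reindex_bij_witness[of _ int nat]) (auto simp: inverse_eq_divide)
      also have "harm (p - 1) \<le> (harm p :: real)" by (rule harm_mono) simp
      also have "\<dots> \<le> 1 + ln (real p)" using p1 by (intro harm_le) simp
      finally show ?thesis using ln1 by simp
    qed
    \<comment> \<open>The residue that is at least \<open>p / (2 Q)\<close> is played off against
      one factor \<open>p\<close>, leaving the reciprocal of the other residue; only single sums of
      reciprocals remain.\<close>
    have big: "\<bar>f n\<bar> \<le> 2 * Q * real p * (1 / of_int \<bar>A n\<bar> + 1 / of_int \<bar>B n\<bar>)"
      if n: "n \<in> {int N<..<int p - int N}" for n
    proof -
      have n': "n \<in> {1..<int p}" using n by auto
      have nz: "A n \<noteq> 0" "B n \<noteq> 0"
        using centered_mod_nonzero[OF cop[OF n' ap] p1] centered_mod_nonzero[OF cop[OF n' bp] p1]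
        by (auto simp: A_def B_def)
      \<comment> \<open>Were both residues smaller, \<open>b A - a B\<close> would be a multiple of
        \<open>p\<close> below \<open>p\<close> in absolute value, hence 0. Coprimality then gives
        \<open>A = a t\<close> and \<open>B = b t\<close> with \<open>t \<equiv> n\<close> modulo
        \<open>p\<close>, and smallness gives \<open>\<bar>t\<bar> \<le> N\<close>. So
        \<open>n - t\<close> would be a multiple of \<open>p\<close> strictly between 0 and
        \<open>p\<close>.\<close>
      have large: "real p \<le> 2 * Q * of_int \<bar>A n\<bar> \<or> real p \<le> 2 * Q * of_int \<bar>B n\<bar>"
      proof (rule ccontr)
        assume "\<not> (real p \<le> 2 * Q * of_int \<bar>A n\<bar> \<or> real p \<le> 2 * Q * of_int \<bar>B n\<bar>)"
        then have lt: "2 * (int a + int b) * \<bar>A n\<bar> < int p" "2 * (int a + int b) * \<bar>B n\<bar> < int p"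
          unfolding Q_def by (simp_all add: not_le flip: of_int_less_iff[where 'a = real])
        have congA: "[A n = int a * n] (mod int p)" and congB: "[B n = int b * n] (mod int p)"
          unfolding A_def B_def by (rule centered_mod_cong)+
        have "[int b * A n = int b * (int a * n)] (mod int p)" "[int a * B n = int a * (int b * n)] (mod int p)"
          by (intro cong_scalar_left congA congB)+
        then have "[int b * A n = int a * B n] (mod int p)"
          by (metis cong_sym cong_trans mult.left_commute)
        then have dvd: "int p dvd int b * A n - int a * B n" by (simp add: cong_iff_dvd_diff)
        have "2 * \<bar>int b * A n - int a * B n\<bar> \<le> 2 * (int b * \<bar>A n\<bar> + int a * \<bar>B n\<bar>)"
          using abs_triangle_ineq4[of "int b * A n" "int a * B n"] by (simp add: abs_mult)
        also have "\<dots> \<le> 2 * (int a + int b) * \<bar>A n\<bar> + 2 * (int a + int b) * \<bar>B n\<bar>"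
          by (simp add: algebra_simps)
        also have "\<dots> < 2 * int p" using lt by linarith
        finally have "\<bar>int b * A n - int a * B n\<bar> < int p" by simp
        then have eq: "int b * A n = int a * B n"
          using dvd dvd_imp_le_int[of "int b * A n - int a * B n" "int p"] by force
        then have "int a dvd int b * A n" by simp
        then have "int a dvd A n" using ab(3) by (simp add: coprime_dvd_mult_right_iff)
        then obtain t where t: "A n = int a * t" by (auto simp: dvd_def)
        then have tB: "B n = int b * t" using eq ab(1) by (auto simp: mult.left_commute)
        have "[int a * t = int a * n] (mod int p)" using congA t by simp
        then have "[t = n] (mod int p)" using ap by (simp add: cong_mult_lcancel)
        then have pn: "int p dvd n - t" by (simp add: cong_iff_dvd_diff dvd_diff_commute)
        have "2 * ((int a + int b)\<^sup>2 * \<bar>t\<bar>) = 2 * (int a + int b) * \<bar>A n\<bar> + 2 * (int a + int b) * \<bar>B n\<bar>"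
          by (simp add: t tB abs_mult power2_eq_square algebra_simps)
        also have "\<dots> < 2 * int p" using lt by linarith
        finally have "(int a + int b)\<^sup>2 * \<bar>t\<bar> < int p" by simp
        then have "(a + b)\<^sup>2 * nat \<bar>t\<bar> < p" by (simp flip: of_nat_less_iff[where 'a = int])
        then have "nat \<bar>t\<bar> \<le> N"
          unfolding N_def using ab by (subst less_eq_div_iff_mult_less_eq) (auto simp: mult.commute)
        then have "\<bar>t\<bar> \<le> int N" by linarith
        then have "0 < n - t" "n - t < int p" using n by auto
        with pn show False using zdvd_imp_le by fastforce
      qed
      have "\<bar>f n\<bar> \<le> (real p)\<^sup>2 * (1 / (of_int \<bar>A n\<bar> * of_int \<bar>B n\<bar>))"
        unfolding f_def A_def B_def by (rule abs_cot_res_mult_le[OF p(1) cop[OF n' ap] cop[OF n' bp]])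
      also have "\<dots> = real p * (real p / (of_int \<bar>A n\<bar> * of_int \<bar>B n\<bar>))"
        by (simp add: power2_eq_square)
      also have "real p / (of_int \<bar>A n\<bar> * of_int \<bar>B n\<bar>) \<le>
          2 * Q * (1 / of_int \<bar>A n\<bar> + 1 / of_int \<bar>B n\<bar>)"
        using large
      proof
        assume "real p \<le> 2 * Q * of_int \<bar>A n\<bar>"
        then have "real p / (of_int \<bar>A n\<bar> * of_int \<bar>B n\<bar>) \<le>
            2 * Q * of_int \<bar>A n\<bar> / (of_int \<bar>A n\<bar> * of_int \<bar>B n\<bar>)"
          by (rule divide_right_mono) simp
        also have "\<dots> = 2 * Q * (1 / of_int \<bar>B n\<bar>)" using nz by simp
        also have "\<dots> \<le> 2 * Q * (1 / of_int \<bar>A n\<bar> + 1 / of_int \<bar>B n\<bar>)"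
          using Q2 by (intro mult_left_mono) auto
        finally show ?thesis .
      next
        assume "real p \<le> 2 * Q * of_int \<bar>B n\<bar>"
        then have "real p / (of_int \<bar>A n\<bar> * of_int \<bar>B n\<bar>) \<le>
            2 * Q * of_int \<bar>B n\<bar> / (of_int \<bar>A n\<bar> * of_int \<bar>B n\<bar>)"
          by (rule divide_right_mono) simp
        also have "\<dots> = 2 * Q * (1 / of_int \<bar>A n\<bar>)" using nz by simp
        also have "\<dots> \<le> 2 * Q * (1 / of_int \<bar>A n\<bar> + 1 / of_int \<bar>B n\<bar>)"
          using Q2 by (intro mult_left_mono) auto
        finally show ?thesis .
      qed
      then have "real p * (real p / (of_int \<bar>A n\<bar> * of_int \<bar>B n\<bar>)) \<le>
          real p * (2 * Q * (1 / of_int \<bar>A n\<bar> + 1 / of_int \<bar>B n\<bar>))"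
        by (rule mult_left_mono) simp
      finally show ?thesis by (simp add: mult_ac)
    qed
    have "\<bar>\<Sum>n\<in>{int N<..<int p - int N}. f n\<bar> \<le>
        (\<Sum>n\<in>{int N<..<int p - int N}. 2 * Q * real p * (1 / of_int \<bar>A n\<bar> + 1 / of_int \<bar>B n\<bar>))"
      by (rule order.trans[OF sum_abs sum_mono]) (rule big)
    also have "\<dots> \<le> (\<Sum>n=1..<int p. 2 * Q * real p * (1 / of_int \<bar>A n\<bar> + 1 / of_int \<bar>B n\<bar>))"
      using Q2 by (intro sum_mono2) auto
    also have "\<dots> = 2 * Q * real p * ((\<Sum>n=1..<int p. 1 / of_int \<bar>A n\<bar>) + (\<Sum>n=1..<int p. 1 / of_int \<bar>B n\<bar>))"
      by (simp only: sum_distrib_left[symmetric] sum.distrib)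
    also have "\<dots> \<le> 2 * Q * real p * (4 * ln (real p) + 4 * ln (real p))"
      using Q2 inv_sum[OF ap] inv_sum[OF bp] unfolding A_def B_def by (intro mult_left_mono add_mono) auto
    finally show ?thesis by simp
  qed
  have main: "2 * (\<gamma> * (pi\<^sup>2 / 6)) = (real p)\<^sup>2 / (3 * real a * real b)"
    by (simp add: \<gamma>_def field_simps)
  \<comment> \<open>The near and tail errors count twice because both ends of the range contribute.
    They lack a logarithm, which \<open>1 \<le> ln p\<close> supplies afterwards.\<close>
  have "\<bar>cot_sum p (int a) (int b) - (real p)\<^sup>2 / (3 * real a * real b)\<bar> \<le>
      2 * real p + 2 * (2 * Q\<^sup>2 * real p) + 16 * Q * (real p * ln (real p))"
    unfolding split main[symmetric] using near tail far by linarith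
  also have "\<dots> = (2 + 4 * Q\<^sup>2) * (real p * 1) + 16 * Q * (real p * ln (real p))"
    by (simp add: algebra_simps)
  also have "\<dots> \<le> (2 + 4 * Q\<^sup>2) * (real p * ln (real p)) + 16 * Q * (real p * ln (real p))"
    using ln1 by (intro add_right_mono mult_left_mono) auto
  finally show ?thesis by (simp add: algebra_simps)
qed

text \<open>The points \<open>(A n, B n)\<close> satisfy \<open>a B \<equiv> h b A\<close> modulo
  \<open>p\<close>. Neither they nor their differences can be shorter than \<open>L\<close>, so the
  bound for separated points applies.\<close>

lemma cot_sum_twisted_bound:
  fixes a b p d :: nat and h :: int
  assumes p: "prime p" "p \<ge> 3" and ab: "a \<ge> 1" "b \<ge> 1"
    and ap: "coprime a p" and bp: "coprime b p"
    and d: "odd d" and hd: "[h ^ d = 1] (mod int p)" and h1: "\<not> [h = 1] (mod int p)"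
  defines "Q \<equiv> real (a + b)"
  defines "K \<equiv> 2 + ln Q"
  shows "\<bar>cot_sum p (int a) (int b * h)\<bar> \<le>
    4 * Q * (2 * K + K\<^sup>2 * Q) * ((real p)\<^sup>2 * (ln (real p))\<^sup>2 * real p powr (- (1 / real (totient d))))"
proof -
  define r where "r = real p powr (- (1 / real (totient d)))"
  \<comment> \<open>The divisor \<open>Q = a + b\<close> compensates for the coefficients
    \<open>a\<close> and \<open>b\<close> in the congruence.\<close>
  define L where "L = real p powr (1 / real (totient d)) / Q"
  define A where "A n = centered_mod p (int a * n)" for n
  define B where "B n = centered_mod p (int b * h * n)" for n
  have p1: "p > 1" using p by simp
  have d0: "d > 0" using d by (auto intro: Nat.gr0I)
  then have phi: "totient d > 0" by simp
  have ln1: "1 \<le> ln (real p)"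
    using one_le_ln[OF p(2)] .
  have Q2: "Q \<ge> 2" using ab by (simp add: Q_def)
  have K: "K \<ge> 2" using Q2 by (simp add: K_def)
  have L0: "L > 0" using p1 Q2 by (simp add: L_def)
  have "1 / L = Q * r" by (simp add: L_def r_def powr_minus_divide)
  then have div_L: "x / L = x * (Q * r)" for x
    by (metis mult.right_neutral times_divide_eq_right)
  have r: "0 < r" "r \<le> 1" using p1 powr_mono[of "- (1 / real (totient d))" 0 "real p"] by (simp_all add: r_def)
  have hp: "coprime h (int p)"
  proof -
    have "coprime (h ^ d) (int p)" using cong_imp_coprime[OF cong_sym[OF hd]] by simp
    then show ?thesis using d0 by simp
  qed
  have copA: "coprime (int a * n) (int p)" and copB: "coprime (int b * h * n) (int p)"
    if "n \<in> {1..<int p}" for n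
    using that coprime_prime_residue[OF p(1)] ap bp hp by simp_all
  \<comment> \<open>The lattice bound is applied to \<open>(b s, a t)\<close>. If both coordinates
    were below \<open>L\<close>, then \<open>b \<bar>s\<bar> + a \<bar>t\<bar>\<close> would be
    below \<open>Q * L = p powr (1 / totient d)\<close>.\<close>
  have short: "L \<le> \<bar>s\<bar> \<or> L \<le> \<bar>t\<bar>" if st: "[int a * t = h * (int b * s)] (mod int p)" "s \<noteq> 0 \<or> t \<noteq> 0" for s t
  proof (rule ccontr)
    assume "\<not> (L \<le> \<bar>s\<bar> \<or> L \<le> \<bar>t\<bar>)"
    then have lt: "\<bar>s\<bar> < L" "\<bar>t\<bar> < L" by auto
    let ?v = "real b * real_of_int \<bar>s\<bar> + real a * real_of_int \<bar>t\<bar>"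
    have "int p \<le> (\<bar>int b * s\<bar> + \<bar>int a * t\<bar>) ^ totient d"
      using st ab by (intro lattice_vector_lower_bound[OF p(1) d hd h1]) auto
    then have "real_of_int (int p) \<le> real_of_int ((\<bar>int b * s\<bar> + \<bar>int a * t\<bar>) ^ totient d)"
      by (simp only: of_int_le_iff)
    then have le: "real p \<le> ?v ^ totient d" by (simp add: abs_mult)
    have "?v \<noteq> 0"
    proof
      assume "?v = 0"
      then show False using le phi p1 by (simp only: power_0_left) simp
    qed
    moreover have "?v \<ge> 0" by simp
    ultimately have "?v > 0" by linarith
    note le
    also have "?v ^ totient d = ?v powr real (totient d)"
      using \<open>?v > 0\<close> by (rule powr_realpow[symmetric])
    finally have "real p powr (1 / real (totient d)) \<le> (?v powr real (totient d)) powr (1 / real (totient d))"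
      by (intro powr_mono2) auto
    also have "\<dots> = ?v" using phi by (simp add: powr_powr)
    finally have "Q * L \<le> ?v" using Q2 by (simp add: L_def)
    moreover have "real b * real_of_int \<bar>s\<bar> < real b * L" "real a * real_of_int \<bar>t\<bar> < real a * L"
      using lt ab by (intro mult_strict_left_mono; simp)+
    ultimately show False by (simp add: Q_def algebra_simps)
  qed
  have rel: "[int a * B n = h * (int b * A n)] (mod int p)" for n
  proof -
    have "[int a * B n = int a * (int b * h * n)] (mod int p)"
      unfolding B_def by (intro cong_scalar_left centered_mod_cong)
    moreover have "[h * (int b * A n) = h * (int b * (int a * n))] (mod int p)"
      unfolding A_def by (intro cong_scalar_left centered_mod_cong)
    moreover have "int a * (int b * h * n) = h * (int b * (int a * n))" by simp
    ultimately show ?thesis by (metis cong_sym cong_trans)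
  qed
  have nz: "A n \<noteq> 0 \<and> B n \<noteq> 0" if "n \<in> {1..<int p}" for n
    using centered_mod_nonzero[OF copA[OF that] p1] centered_mod_nonzero[OF copB[OF that] p1]
    by (auto simp: A_def B_def)
  define H where "H = (harm (nat \<lfloor>real p / L\<rfloor>) :: real)"
  have "\<bar>cot_sum p (int a) (int b * h)\<bar> \<le>
      (\<Sum>n=1..<int p. (real p)\<^sup>2 * (1 / (of_int \<bar>A n\<bar> * of_int \<bar>B n\<bar>)))"
    unfolding cot_sum_def A_def B_def
    by (rule order.trans[OF sum_abs sum_mono]) (rule abs_cot_res_mult_le[OF p(1) copA copB])
  also have "\<dots> = (real p)\<^sup>2 * (\<Sum>n=1..<int p. 1 / (of_int \<bar>A n\<bar> * of_int \<bar>B n\<bar>))"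
    by (simp only: sum_distrib_left)
  also have "(\<Sum>n=1..<int p. 1 / (of_int \<bar>A n\<bar> * of_int \<bar>B n\<bar>)) \<le> 4 * ((1 + H / L)\<^sup>2 - 1)"
    unfolding H_def
  proof (rule sum_inverse_products_separated[OF _ L0])
    fix n assume n: "n \<in> {1..<int p}"
    show "A n \<noteq> 0 \<and> B n \<noteq> 0" by (rule nz[OF n])
    have "2 * \<bar>A n\<bar> \<le> int p" "2 * \<bar>B n\<bar> \<le> int p"
      unfolding A_def B_def using p1 by (intro centered_mod_bound; simp)+
    then show "\<bar>A n\<bar> \<le> real p \<and> \<bar>B n\<bar> \<le> real p" by linarith
    show "L \<le> \<bar>A n\<bar> \<or> L \<le> \<bar>B n\<bar>" using short[OF rel] nz[OF n] by blast
    fix m assume m: "m \<in> {1..<int p}" "n \<noteq> m"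
    \<comment> \<open>\<open>A n\<close> determines \<open>n\<close> modulo \<open>p\<close>, so
      distinct indices give a nonzero difference vector, which satisfies the same linear
      congruence.\<close>
    have "A n \<noteq> A m"
    proof
      assume "A n = A m"
      then have "[int a * n = int a * m] (mod int p)"
        unfolding A_def by (metis centered_mod_cong cong_sym cong_trans)
      then have "[n = m] (mod int p)" using ap by (simp add: cong_mult_lcancel)
      then show False using m n by (simp add: unique_euclidean_semiring_class.cong_def)
    qed
    moreover have "[int a * (B n - B m) = h * (int b * (A n - A m))] (mod int p)"
      using cong_diff[OF rel[of n] rel[of m]] by (simp add: right_diff_distrib)
    ultimately show "L \<le> \<bar>A n - A m\<bar> \<or> L \<le> \<bar>B n - B m\<bar>" by (intro short) auto
  qed simp
  also have "4 * ((1 + H / L)\<^sup>2 - 1) \<le> 4 * Q * (2 * K + K\<^sup>2 * Q) * ((ln (real p))\<^sup>2 * r)"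
  proof -
    let ?l = "ln (real p)"
    have H0: "H \<ge> 0" by (simp add: H_def harm_nonneg)
    \<comment> \<open>This is the origin of \<open>K\<close>: the strip index is at most
      \<open>p * Q\<close>, so \<open>H \<le> 1 + ln p + ln Q\<close>, and
      \<open>1 \<le> ln p\<close> merges the constants. If the only strip index is 0, the harmonic
      number is 0.\<close>
    have HK: "H \<le> K * ?l"
    proof (cases "nat \<lfloor>real p / L\<rfloor> = 0")
      case True
      then show ?thesis using K ln1 by (simp add: H_def harm_def)
    next
      case False
      let ?J = "nat \<lfloor>real p / L\<rfloor>"
      have "real ?J \<le> real p / L" using L0 by simp
      also have "\<dots> = real p * Q * r" by (simp add: div_L)
      also have "\<dots> \<le> real p * Q" using r Q2 by (intro mult_left_le) auto
      finally have "ln (real ?J) \<le> ln (real p * Q)" using False p1 Q2 by (subst ln_le_cancel_iff) (auto intro: mult_pos_pos)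
      moreover have "ln (real p * Q) = ?l + ln Q" using p1 Q2 by (intro ln_mult_pos) auto
      ultimately have "H \<le> 1 + ?l + ln Q" using harm_le[of ?J] False by (simp add: H_def)
      also have "1 + ?l + ln Q = ?l + (1 + ln Q) * 1" by simp
      also have "\<dots> \<le> ?l + (1 + ln Q) * ?l" using ln1 Q2 by (intro add_left_mono mult_left_mono) auto
      also have "\<dots> = K * ?l" by (simp add: K_def algebra_simps)
      finally show ?thesis .
    qed
    have "(1 + H / L)\<^sup>2 - 1 = 2 * H * (Q * r) + H\<^sup>2 * (Q * r)\<^sup>2"
      by (simp add: div_L power2_eq_square algebra_simps)
    also have "\<dots> \<le> 2 * (K * ?l) * (Q * r) + (K * ?l)\<^sup>2 * (Q * r)\<^sup>2"
      using H0 HK r Q2 by (intro add_mono mult_right_mono power_mono mult_left_mono) auto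
    also have "\<dots> = 2 * K * Q * r * ?l + K\<^sup>2 * Q\<^sup>2 * r * ?l\<^sup>2 * r"
      by (simp add: power2_eq_square)
    \<comment> \<open>Replacing \<open>ln p\<close> by its square in the first term and one factor
      \<open>r\<close> by 1 in the second gives both the shape \<open>r (ln p)^2\<close>.\<close>
    also have "\<dots> \<le> 2 * K * Q * r * ?l\<^sup>2 + K\<^sup>2 * Q\<^sup>2 * r * ?l\<^sup>2 * 1"
    proof (intro add_mono mult_left_mono)
      show "?l \<le> ?l\<^sup>2" using ln1 by (simp add: power2_eq_square)
    qed (use K Q2 r in auto)
    also have "\<dots> = Q * (2 * K + K\<^sup>2 * Q) * (?l\<^sup>2 * r)"
      by (simp add: power2_eq_square algebra_simps)
    finally show ?thesis by simp
  qed
  finally have "\<bar>cot_sum p (int a) (int b * h)\<bar> \<le>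
      (real p)\<^sup>2 * (4 * Q * (2 * K + K\<^sup>2 * Q) * ((ln (real p))\<^sup>2 * r))"
    by (simp add: mult_left_mono)
  then show ?thesis by (simp add: r_def mult_ac)
qed

section \<open>The mean square\<close>

text \<open>This settles the primes dividing \<open>q1 * q2\<close>, where every summand contains a
  vanishing character value.\<close>

lemma mean_square_eq_0:
  assumes p: "prime p" and "\<not> coprime q1 p \<or> \<not> coprime q2 p"
  shows "mean_square q1 q2 p H = 0"
proof -
  have "\<psi> (int q1) * cnj (\<psi> (int q2)) = 0" if "\<psi> \<in> odd_chars p H" for \<psi>
    using that assms by (auto simp: odd_chars_def dirichlet_character_def)
  then have "(\<Sum>\<psi>\<in>odd_chars p H. \<psi> (int q1) * cnj (\<psi> (int q2)) *
      complex_of_real ((cmod (L_one \<psi>))\<^sup>2)) = 0"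
    by (intro sum.neutral ballI) simp
  then show ?thesis by (simp add: mean_square_def)
qed

theorem theorem3p9:
  fixes q1 q2 :: nat
  assumes "q1 \<ge> 1" and "q2 \<ge> 1" and "coprime q1 q2"
  shows "\<exists>C::real. \<forall>(p::nat) (d::nat) (H::int set).
           prime p \<longrightarrow> p \<ge> 3 \<longrightarrow>
           subgroup H (unit_group_mod p) \<longrightarrow> card H = d \<longrightarrow> odd d \<longrightarrow>
           cmod (mean_square q1 q2 p H - complex_of_real (pi\<^sup>2 / (6 * real q1 * real q2)))
             \<le> C * (real d * (ln (real p))\<^sup>2 * real p powr (- (1 / real (totient d))))"
proof -
  define Q where "Q = real (q1 + q2)"
  define K where "K = 2 + ln Q"
  define C0 where "C0 = 2 + 4 * Q\<^sup>2 + 16 * Q"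
  define C1 where "C1 = 4 * Q * (2 * K + K\<^sup>2 * Q)"
  have Q2: "Q \<ge> 2" using assms by (simp add: Q_def)
  then have K: "K \<ge> 2" by (simp add: K_def)
  have C: "C0 \<ge> 0" "C1 \<ge> 0" using Q2 K by (simp_all add: C0_def C1_def)
  \<comment> \<open>In the constant, \<open>pi^2 / 6\<close> serves the primes dividing
    \<open>q1 * q2\<close>. The other part combines the bounds for \<open>h = 1\<close> and
    \<open>h \<noteq> 1\<close> with the factor \<open>pi^2 / 2\<close> of the cotangent
    formula.\<close>
  show ?thesis
  proof (intro exI[of _ "pi\<^sup>2 / 6 + pi\<^sup>2 / 2 * (C0 + C1)"] allI impI)
    fix p d :: nat and H :: "int set"
    assume p: "prime p" "p \<ge> 3" and H: "subgroup H (unit_group_mod p)" and card: "card H = d" and d: "odd d"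
    define l where "l = ln (real p)"
    define r where "r = real p powr (- (1 / real (totient d)))"
    define E where "E = real d * l\<^sup>2 * r"
    have p1: "p > 1" using p by simp
    have d0: "d > 0" using d by (auto intro: Nat.gr0I)
    then have phi: "totient d \<ge> 1" by (simp add: Suc_le_eq)
    have l1: "1 \<le> l"
      using one_le_ln[OF p(2)] by (simp add: l_def)
    \<comment> \<open>Since \<open>totient d \<ge> 1\<close>, the exponent is at least - 1, so
      errors of order \<open>1 / p\<close> fit into the error term.\<close>
    have r: "0 < r" "1 / real p \<le> r"
    proof -
      have "1 / real (totient d) \<le> 1" using phi d0 by (subst divide_le_eq_1_pos) auto
      then have "real p powr (- 1) \<le> r"
        unfolding r_def using p1 by (intro powr_mono) auto
      then show "1 / real p \<le> r" using p1 by (simp add: powr_minus_divide)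
    qed (use p1 in \<open>simp add: r_def\<close>)
    have l2: "l \<le> l\<^sup>2" "1 \<le> l\<^sup>2" using l1 by (auto simp: power2_eq_square intro: order.trans[OF l1])
    have rE: "r \<le> E"
    proof -
      have "1 * 1 * r \<le> real d * l\<^sup>2 * r" using d0 l2 r by (intro mult_mono) auto
      then show ?thesis by (simp add: E_def)
    qed
    have E0: "E \<ge> 0" using rE r by simp
    show "cmod (mean_square q1 q2 p H - complex_of_real (pi\<^sup>2 / (6 * real q1 * real q2)))
       \<le> (pi\<^sup>2 / 6 + pi\<^sup>2 / 2 * (C0 + C1)) * (real d * (ln (real p))\<^sup>2 * real p powr (- (1 / real (totient d))))"
      unfolding l_def[symmetric] r_def[symmetric] E_def[symmetric]
    proof (cases "coprime q1 p \<and> coprime q2 p")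
      \<comment> \<open>Here the mean is 0 and \<open>p \<le> q1 * q2\<close>, so the main term
        itself is at most \<open>pi^2 / (6 p)\<close>.\<close>
      case False
      then have "p dvd q1 \<or> p dvd q2" using p(1) by (metis coprime_commute prime_imp_coprime)
      then have "p dvd q1 * q2" by auto
      then have "p \<le> q1 * q2" using assms by (intro dvd_imp_le) auto
      then have "real p \<le> real (q1 * q2)" by (simp only: of_nat_le_iff)
      then have "1 / real (q1 * q2) \<le> 1 / real p" using p1 by (intro divide_left_mono) auto
      also have "\<dots> \<le> E" using r rE by simp
      finally have "pi\<^sup>2 / 6 * (1 / real (q1 * q2)) \<le> pi\<^sup>2 / 6 * E" by (intro mult_left_mono) auto
      moreover have "pi\<^sup>2 / 2 * (C0 + C1) * E \<ge> 0" using C E0 by simp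
      moreover have "cmod (mean_square q1 q2 p H - complex_of_real (pi\<^sup>2 / (6 * real q1 * real q2))) =
          pi\<^sup>2 / 6 * (1 / real (q1 * q2))"
        using mean_square_eq_0[OF p(1)] False by (simp add: norm_divide norm_mult norm_power)
      ultimately show "cmod (mean_square q1 q2 p H - complex_of_real (pi\<^sup>2 / (6 * real q1 * real q2)))
          \<le> (pi\<^sup>2 / 6 + pi\<^sup>2 / 2 * (C0 + C1)) * E"
        by (simp only: distrib_right)
    next
      case True
      let ?D = "\<lambda>h. cot_sum p (int q1) (int q2 * h)"
      let ?m = "(real p)\<^sup>2 / (3 * real q1 * real q2)"
      note sub = subgroup_subset[OF p(1) H]
      have fin: "finite H" using sub by (rule finite_subset) simp
      have one: "\<bar>?D 1 - ?m\<bar> \<le> C0 * ((real p)\<^sup>2 * E)"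
      proof -
        have "\<bar>?D 1 - ?m\<bar> \<le> C0 * (real p * l)"
          using cot_sum_principal[OF p assms] True unfolding C0_def Q_def l_def by simp
        \<comment> \<open>In this form the comparison with \<open>d * l^2 * r\<close> is factorwise,
          by \<open>1 \<le> d\<close>, \<open>l \<le> l^2\<close> and
          \<open>1 / p \<le> r\<close>.\<close>
        also have "real p * l = (real p)\<^sup>2 * (1 * l * (1 / real p))" using p1 by (simp add: power2_eq_square)
        also have "C0 * \<dots> \<le> C0 * ((real p)\<^sup>2 * (real d * l\<^sup>2 * r))"
          using C d0 l1 l2 r by (intro mult_left_mono mult_mono) auto
        finally show ?thesis by (simp add: E_def)
      qed
      \<comment> \<open>The twisted bound is uniform in \<open>h\<close>; summing it over at most
        \<open>d\<close> elements produces the factor \<open>d\<close> of the error term.\<close>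
      have rest: "\<bar>\<Sum>h\<in>H - {1}. ?D h\<bar> \<le> C1 * ((real p)\<^sup>2 * E)"
      proof -
        have "\<bar>\<Sum>h\<in>H - {1}. ?D h\<bar> \<le> (\<Sum>h\<in>H - {1}. C1 * ((real p)\<^sup>2 * l\<^sup>2 * r))"
        proof (rule order.trans[OF sum_abs sum_mono])
          fix h assume h: "h \<in> H - {1}"
          then have "[h ^ d = 1] (mod int p)" using subgroup_power_card[OF p(1) H] card by auto
          moreover have "\<not> [h = 1] (mod int p)"
            using h sub p1 by (auto simp: unique_euclidean_semiring_class.cong_def)
          ultimately show "\<bar>?D h\<bar> \<le> C1 * ((real p)\<^sup>2 * l\<^sup>2 * r)"
            using cot_sum_twisted_bound[OF p assms(1,2) _ _ d] True
            unfolding C1_def K_def Q_def l_def r_def by simp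
        qed
        also have "\<dots> = real (card (H - {1})) * (C1 * ((real p)\<^sup>2 * l\<^sup>2 * r))" by simp
        also have "\<dots> \<le> real d * (C1 * ((real p)\<^sup>2 * l\<^sup>2 * r))"
          using C r card card_Diff1_le[of H 1] by (intro mult_right_mono) auto
        finally show ?thesis by (simp add: E_def mult_ac)
      qed
      have "mean_square q1 q2 p H - complex_of_real (pi\<^sup>2 / (6 * real q1 * real q2)) =
          of_real (pi\<^sup>2 / (2 * (real p)\<^sup>2) * ((?D 1 - ?m) + (\<Sum>h\<in>H - {1}. ?D h)))"
      proof -
        have "(\<Sum>h\<in>H. ?D h) = ?D 1 + (\<Sum>h\<in>H - {1}. ?D h)"
          using one_in_subgroup[OF p(1) H] fin by (subst sum.remove[of _ 1]) auto
        moreover have "pi\<^sup>2 / (6 * real q1 * real q2) = pi\<^sup>2 / (2 * (real p)\<^sup>2) * ?m"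
          using p1 by (simp add: field_simps)
        moreover have "mean_square q1 q2 p H = of_real (pi\<^sup>2 / (2 * (real p)\<^sup>2) * (\<Sum>h\<in>H. ?D h))"
          using mean_square_eq_cot_sum[OF p H] card d True by simp
        ultimately show ?thesis
          by (simp only: of_real_diff[symmetric] right_diff_distrib[symmetric] add_diff_eq diff_add_eq)
      qed
      then have "cmod (mean_square q1 q2 p H - complex_of_real (pi\<^sup>2 / (6 * real q1 * real q2))) =
          pi\<^sup>2 / (2 * (real p)\<^sup>2) * \<bar>(?D 1 - ?m) + (\<Sum>h\<in>H - {1}. ?D h)\<bar>"
        by (simp only: norm_of_real abs_mult) simp
      also have "\<dots> \<le> pi\<^sup>2 / (2 * (real p)\<^sup>2) * (C0 * ((real p)\<^sup>2 * E) + C1 * ((real p)\<^sup>2 * E))"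
        by (intro mult_left_mono order.trans[OF abs_triangle_ineq] add_mono one rest) simp
      also have "\<dots> = pi\<^sup>2 / 2 * (C0 + C1) * E" using p1 by (simp add: field_simps)
      also have "\<dots> \<le> (pi\<^sup>2 / 6 + pi\<^sup>2 / 2 * (C0 + C1)) * E" using E0 by (intro mult_right_mono) auto
      finally show "cmod (mean_square q1 q2 p H - complex_of_real (pi\<^sup>2 / (6 * real q1 * real q2)))
          \<le> (pi\<^sup>2 / 6 + pi\<^sup>2 / 2 * (C0 + C1)) * E" .
    qed
  qed
qed

end
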